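(* Let $k\geq 3$ be an integer. Then $\mathcal{D}_k(\vec{C}_7\langle 3\rangle)$ is connected and has diameter $8$.
   Context: $\vec{C}_7\langle 3\rangle$ is the tournament with vertex set $\mathbb{Z}_7$ and arcs $(a,a+1)$, $(a,a+2)$, $(a,a-3)$ for all $a\in\mathbb{Z}_7$ (equivalently the Paley tournament $\vec{C}_7(1,2,4)$). A $k$-coloring of a digraph $D$ is a function $\alpha\colon V(D)\to\{1,\dots,k\}$ such that every color class $\{x:\alpha(x)=i\}$ (possibly empty) induces an acyclic subdigraph. The $k$-dicoloring graph $\mathcal{D}_k(D)$ has the $k$-colorings of $D$ as vertices, two being adjacent iff they differ on exactly one vertex. *)

theory Defs
  imports "Graph_Theory.Graph_Theory" "HOL-Library.Numeral_Type" "HOL-Library.FuncSet"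
begin

(* The numeral type 7 is the ring of integers modulo 7, so the arithmetic below is modular. *)
definition C7_3 :: "(7, 7 \<times> 7) pre_digraph" where
  "C7_3 = with_proj \<lparr> pverts = UNIV, parcs = (\<Union>a. {(a, a + 1), (a, a + 2), (a, a - 3)}) \<rparr>"

definition acyclic_digraph :: "('a, 'b) pre_digraph \<Rightarrow> bool" where
  "acyclic_digraph D \<longleftrightarrow> \<not> (\<exists>p. pre_digraph.cycle D p)"

(* Colorings are extensional functions, so that two colorings are equal as soon as they
   agree on the vertices. *)
definition dicolorings :: "nat \<Rightarrow> ('a, 'b) pre_digraph \<Rightarrow> ('a \<Rightarrow> nat) set" where
  "dicolorings k D = {\<alpha> \<in> verts D \<rightarrow>\<^sub>E {1..k}.
     \<forall>i\<in>{1..k}. acyclic_digraph (D \<restriction> {x \<in> verts D. \<alpha> x = i})}"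

(* As usual in Graph_Theory, an undirected graph is a symmetric digraph. *)
definition dicoloring_graph ::
    "nat \<Rightarrow> ('a, 'b) pre_digraph \<Rightarrow> ('a \<Rightarrow> nat, ('a \<Rightarrow> nat) \<times> ('a \<Rightarrow> nat)) pre_digraph" where
  "dicoloring_graph k D = with_proj
     \<lparr> pverts = dicolorings k D,
       parcs = {(\<alpha>, \<beta>). \<alpha> \<in> dicolorings k D \<and> \<beta> \<in> dicolorings k D \<and>
                        (\<exists>!x. x \<in> verts D \<and> \<alpha> x \<noteq> \<beta> x)} \<rparr>"

lemma graph_properties_dicoloring_graph:
  "wf_digraph (dicoloring_graph k D)" "loopfree_digraph (dicoloring_graph k D)"
  "sym_digraph (dicoloring_graph k D)"
proof -
  show "wf_digraph (dicoloring_graph k D)"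
    by unfold_locales (auto simp: dicoloring_graph_def)
  then interpret wf_digraph "dicoloring_graph k D" .
  show "loopfree_digraph (dicoloring_graph k D)"
    by unfold_locales (auto simp: dicoloring_graph_def)
  have "sym (arcs_ends (dicoloring_graph k D))"
    unfolding dicoloring_graph_def by (auto intro!: symI)
  then show "sym_digraph (dicoloring_graph k D)"
    by unfold_locales (simp add: symmetric_def)
qed

(* With unit weights, the cost of a walk is its length; the distance between vertices
   that no walk joins is infinite. *)
definition graph_dist :: "('a, 'b) pre_digraph \<Rightarrow> 'a \<Rightarrow> 'a \<Rightarrow> ereal" where
  "graph_dist G u v = wf_digraph.\<mu> G (\<lambda>_. 1) u v"

definition graph_diameter :: "('a, 'b) pre_digraph \<Rightarrow> ereal" where
  "graph_diameter G = (SUP u\<in>verts G. SUP v\<in>verts G. graph_dist G u v)"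

end

theory Submission
  imports Defs
begin

text \<open>
  A set of vertices of the tournament is acyclic iff it contains no cyclic triangle, so colorings are
  maps for which no cyclic triangle is monochromatic. We prove the upper bound in the stronger form
  that, for every vertex set \<open>S\<close> and at least three colors, two colorings of \<open>S\<close> are joined by at most
  \<open>card S + 1\<close> recolorings. Let \<open>f\<close> and \<open>g\<close> be the colorings. If for some color \<open>c\<close> the set
  \<open>U\<close> of vertices that \<open>f\<close> or \<open>g\<close> colors \<open>c\<close> contains no cyclic triangle, then move all of
  \<open>U\<close> to \<open>c\<close>, solve the problem for \<open>S - U\<close> without the color \<open>c\<close>, and finally move the vertices of
  \<open>U\<close> to their colors under \<open>g\<close>: this recolors no vertex of \<open>U\<close> twice. If there is no such color among
  \<open>k\<close>, then every color occurs at least three times in \<open>f\<close> and \<open>g\<close> together, so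
  \<open>3 * k \<le> 2 * card S \<le> 14\<close>, which leaves only \<open>k = 4\<close> and \<open>card S \<ge> 6\<close>. This case and
  the case \<open>k = 3\<close> are finite and are settled by evaluation, up to permutations of the colors and the
  21 automorphisms \<open>x \<mapsto> a * x + b\<close> with \<open>a \<in> {1, 2, 4}\<close>.

  For the lower bound we exhibit two 3-colorings that differ at all seven vertices, such that no order
  of the vertices allows to give each vertex its final color directly. A walk between them
  therefore has at least eight steps, whatever the number of colors.
\<close>

section \<open>Recoloring hypergraphs\<close>


definition proper :: "'v set set \<Rightarrow> 'v set \<Rightarrow> ('v \<Rightarrow> 'c) \<Rightarrow> bool" where
  "proper H S f \<longleftrightarrow> (\<forall>T\<in>H. T \<subseteq> S \<longrightarrow> \<not> (\<exists>c. \<forall>x\<in>T. f x = c))"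

primrec reach ::
    "'v set set \<Rightarrow> 'v set \<Rightarrow> 'c set \<Rightarrow> nat \<Rightarrow> ('v \<Rightarrow> 'c) \<Rightarrow> ('v \<Rightarrow> 'c) \<Rightarrow> bool" where
  "reach H S K 0 f g = (\<forall>x\<in>S. f x = g x)"
| "reach H S K (Suc n) f g = ((\<forall>x\<in>S. f x = g x) \<or>
     (\<exists>x\<in>S. \<exists>c\<in>K. proper H S (f(x := c)) \<and> reach H S K n (f(x := c)) g))"

lemma proper_cong:
  assumes "\<And>x. x \<in> S \<Longrightarrow> f x = f' x"
  shows "proper H S f = proper H S f'"
  unfolding proper_def using assms by (metis subset_iff)

lemma proper_mono: "proper H S f \<Longrightarrow> S' \<subseteq> S \<Longrightarrow> proper H S' f"
  unfolding proper_def by blast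

lemma reach_cong:
  assumes "\<And>x. x \<in> S \<Longrightarrow> f x = f' x" "\<And>x. x \<in> S \<Longrightarrow> g x = g' x"
  shows "reach H S K n f g = reach H S K n f' g'"
  using assms
proof (induction n arbitrary: f f')
  case (Suc n)
  have "proper H S (f(x := c)) = proper H S (f'(x := c))"
       "reach H S K n (f(x := c)) g = reach H S K n (f'(x := c)) g'" for x c
    using Suc.prems by (intro proper_cong Suc.IH; simp)+
  then show ?case using Suc.prems by auto
qed auto

lemma reach_refl: "reach H S K n f f"
  by (cases n) auto

lemma reach_mono: "reach H S K n f g \<Longrightarrow> n \<le> m \<Longrightarrow> reach H S K m f g"
proof (induction m arbitrary: n f)
  case (Suc m)
  show ?case
  proof (cases n)
    case 0
    then show ?thesis using Suc.prems by simp
  next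
    case (Suc n')
    then show ?thesis using Suc.prems Suc.IH[of n'] by auto
  qed
qed simp

lemma reach_trans: "reach H S K n f g \<Longrightarrow> reach H S K m g h \<Longrightarrow> reach H S K (n + m) f h"
proof (induction n arbitrary: f)
  case 0
  then show ?case using reach_cong[of S f g h h] by auto
next
  case (Suc n)
  show ?case
  proof (cases "\<forall>x\<in>S. f x = g x")
    case True
    then have "reach H S K m f h" using Suc.prems(2) reach_cong[of S f g h h] by auto
    then show ?thesis by (rule reach_mono) simp
  qed (use Suc in auto)
qed

lemma reach_step:
  assumes "x \<in> S" "c \<in> K" "proper H S (f(x := c))"
  shows "reach H S K 1 f (f(x := c))"
  unfolding One_nat_def reach.simps(2) using assms reach_refl[of H S K 0] by blast

lemma reach_sym:
  "reach H S K n f g \<Longrightarrow> proper H S f \<Longrightarrow> f ` S \<subseteq> K \<Longrightarrow> reach H S K n g f"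
proof (induction n arbitrary: f)
  case (Suc n)
  show ?case
  proof (cases "\<forall>x\<in>S. f x = g x")
    case False
    then obtain x c where x: "x \<in> S" "c \<in> K" "proper H S (f(x := c))"
      "reach H S K n (f(x := c)) g"
      using Suc.prems by auto
    then have "reach H S K n g (f(x := c))"
      using Suc.IH[of "f(x := c)"] Suc.prems by fastforce
    moreover have "reach H S K 1 (f(x := c)) f"
      using reach_step[of x S "f x" K H "f(x := c)"] x Suc.prems by (simp add: image_subset_iff)
    ultimately show ?thesis using reach_trans[of H S K n g "f(x := c)" 1 f] by simp
  next
    case True
    then show ?thesis by (simp add: eq_commute)
  qed
qed simp

lemma reach_image_color:
  assumes "reach H S K n f g" "inj_on s K" "f ` S \<subseteq> K" "g ` S \<subseteq> K"
  shows "reach H S (s ` K) n (s \<circ> f) (s \<circ> g)"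
  using assms
proof (induction n arbitrary: f)
  case (Suc n)
  show ?case
  proof (cases "\<forall>x\<in>S. f x = g x")
    case False
    then obtain x c where x: "x \<in> S" "c \<in> K" "proper H S (f(x := c))"
      "reach H S K n (f(x := c)) g"
      using Suc.prems by auto
    have K: "f(x := c) ` S \<subseteq> K" using x Suc.prems by auto
    have "proper H S (s \<circ> f(x := c))"
      unfolding proper_def
    proof (intro ballI impI notI, elim exE)
      fix T d assume T: "T \<in> H" "T \<subseteq> S" "\<forall>y\<in>T. (s \<circ> f(x := c)) y = d"
      then have "(f(x := c)) y = (f(x := c)) z" if "y \<in> T" "z \<in> T" for y z
        using that K inj_onD[OF Suc.prems(2), of "(f(x := c)) y" "(f(x := c)) z"]
        by (metis comp_apply image_subset_iff subset_iff)
      then have "\<exists>e. \<forall>y\<in>T. (f(x := c)) y = e" by blast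
      then show False using x(3) T unfolding proper_def by blast
    qed
    moreover have "reach H S (s ` K) n (s \<circ> f(x := c)) (s \<circ> g)"
      using Suc.IH[of "f(x := c)"] x K Suc.prems by blast
    moreover have "s \<circ> f(x := c) = (s \<circ> f)(x := s c)" by auto
    ultimately have "proper H S ((s \<circ> f)(x := s c)) \<and>
        reach H S (s ` K) n ((s \<circ> f)(x := s c)) (s \<circ> g)" by simp
    then show ?thesis unfolding reach.simps(2) using x(1,2) by blast
  qed auto
qed auto

lemma proper_image_vertex:
  assumes "bij p"
  shows "proper ((`) p ` H) (p ` S) f \<longleftrightarrow> proper H S (f \<circ> p)"
  using assms unfolding proper_def by (simp add: bij_is_inj inj_image_subset_iff)

lemma reach_image_vertex:
  assumes "bij p"
  shows "reach ((`) p ` H) (p ` S) K n f g \<longleftrightarrow> reach H S K n (f \<circ> p) (g \<circ> p)"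
proof (induction n arbitrary: f)
  case (Suc n)
  have eq: "f(p x := c) \<circ> p = (f \<circ> p)(x := c)" for x c
    using assms by (auto simp: fun_eq_iff bij_def inj_eq)
  show ?case
    unfolding reach.simps ball_simps bex_simps Suc.IH proper_image_vertex[OF assms] eq by simp
qed auto

lemma reach_fill:
  assumes "finite D" "D \<subseteq> S" "c \<in> K" "proper H S f"
    "\<not> (\<exists>T\<in>H. T \<subseteq> D \<union> {x\<in>S. f x = c})"
  shows "proper H S (\<lambda>x. if x \<in> D then c else f x) \<and>
    reach H S K (card D) f (\<lambda>x. if x \<in> D then c else f x)"
  using assms
proof (induction D)
  case (insert y D)
  let ?f = "\<lambda>x. if x \<in> D then c else f x"
  let ?g = "\<lambda>x. if x \<in> insert y D then c else f x"
  have eq: "?g = ?f(y := c)" by auto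
  have IH: "proper H S ?f" "reach H S K (card D) f ?f" using insert by blast+
  have pg: "proper H S ?g"
    unfolding proper_def
  proof (intro ballI impI notI, elim exE)
    fix T d assume T: "T \<in> H" "T \<subseteq> S" "\<forall>x\<in>T. ?g x = d"
    show False
    proof (cases "d = c")
      case True
      then have "T \<subseteq> insert y D \<union> {x\<in>S. f x = c}" using T by fastforce
      then show False using T insert.prems by blast
    next
      case False
      then have "\<forall>x\<in>T. f x = d" using T by (metis (full_types))
      then show False using T insert.prems unfolding proper_def by blast
    qed
  qed
  have "reach H S K (card D + 1) f ?g"
    unfolding eq using reach_trans[OF IH(2) reach_step[of y S c K H ?f]] insert.prems pg
    unfolding eq by blast
  then show ?case using pg insert by simp
qed (simp add: reach_refl)

lemma reach_lift:
  assumes "reach H (S - U) (K - {c}) m f g" "\<And>x. x \<in> U \<Longrightarrow> f x = c" "\<And>x. x \<in> U \<Longrightarrow> g x = c"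
    "\<not> (\<exists>T\<in>H. T \<subseteq> U)" "\<And>x. x \<in> S - U \<Longrightarrow> f x \<noteq> c"
  shows "reach H S K m f g"
  using assms
proof (induction m arbitrary: f)
  case (Suc m)
  show ?case
  proof (cases "\<forall>x\<in>S. f x = g x")
    case False
    then obtain x d where x: "x \<in> S - U" "d \<in> K - {c}" "proper H (S - U) (f(x := d))"
      "reach H (S - U) (K - {c}) m (f(x := d)) g"
    proof -
      have "\<not> (\<forall>x\<in>S - U. f x = g x)" using False Suc.prems(2,3) by auto
      then show thesis using that Suc.prems(1) unfolding reach.simps by blast
    qed
    let ?f = "f(x := d)"
    have "proper H S ?f"
      unfolding proper_def
    proof (intro ballI impI notI, elim exE)
      fix T e assume T: "T \<in> H" "T \<subseteq> S" "\<forall>y\<in>T. ?f y = e"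
      show False
      proof (cases "e = c")
        case True
        then have "y \<in> U" if "y \<in> T" for y
          using T(2,3) that x(2) Suc.prems(5)[of y] by (auto split: if_splits)
        then have "T \<subseteq> U" by blast
        then show False using T Suc.prems(4) by blast
      next
        case False
        have "?f y = c" if "y \<in> U" for y using that x(1) Suc.prems(2) by auto
        then have "T \<subseteq> S - U" using T(2,3) False by auto
        then show False using x(3) T unfolding proper_def by blast
      qed
    qed
    moreover have "reach H S K m ?f g"
      by (rule Suc.IH[OF x(4) _ Suc.prems(3,4)])
        (use x(1,2) Suc.prems(2,5) in \<open>auto split: if_splits\<close>)
    ultimately show ?thesis unfolding reach.simps using x(1,2) by blast
  qed simp
qed auto

lemma reach_remove_class:
  fixes f g :: "'v \<Rightarrow> 'c"
  assumes "finite S" "c \<in> K" "proper H S f" "proper H S g" "f ` S \<subseteq> K" "g ` S \<subseteq> K"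
    and U: "U = {x\<in>S. f x = c \<or> g x = c}" "\<not> (\<exists>T\<in>H. T \<subseteq> U)"
    and r: "reach H (S - U) (K - {c}) m f g"
  shows "reach H S K (card U + m) f g"
proof -
  define over where "over h = (\<lambda>x. if x \<in> {x\<in>U. h x \<noteq> c} then c else h x)" for h :: "'v \<Rightarrow> 'c"
  have over: "over h x = (if x \<in> U then c else h x)" for h x
    unfolding over_def by auto
  have fin: "finite U" using assms by auto
  have fill: "proper H S (over h) \<and> reach H S K (card {x\<in>U. h x \<noteq> c}) h (over h)"
    if "proper H S h" "{x\<in>S. h x = c} \<subseteq> U" for h
  proof -
    have "{x\<in>U. h x \<noteq> c} \<union> {x\<in>S. h x = c} \<subseteq> U" using that by auto
    then show ?thesis
      unfolding over_def using reach_fill[of "{x\<in>U. h x \<noteq> c}" S c K H h] that U fin assms(2)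
      by (smt (verit, best) finite_subset mem_Collect_eq subset_iff subset_trans)
  qed
  have 1: "reach H S K (card {x\<in>U. f x \<noteq> c}) f (over f)" using fill assms by auto
  have 2: "reach H S K m (over f) (over g)"
  proof (rule reach_lift[of H S U K c])
    show "reach H (S - U) (K - {c}) m (over f) (over g)"
      using r reach_cong[of "S - U" f "over f" g "over g"] by (simp add: over)
  qed (use U in \<open>auto simp: over\<close>)
  have 3: "reach H S K (card {x\<in>U. g x \<noteq> c}) (over g) g"
    using fill[of g] reach_sym[of H S K _ g "over g"] assms by auto
  have "card {x\<in>U. f x \<noteq> c} + card {x\<in>U. g x \<noteq> c} = card ({x\<in>U. f x \<noteq> c} \<union> {x\<in>U. g x \<noteq> c})"
    using fin by (intro card_Un_disjoint[symmetric]) (simp_all, use U(1) in blast)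
  also have "\<dots> \<le> card U" using fin by (intro card_mono) auto
  finally have "card {x\<in>U. f x \<noteq> c} + m + card {x\<in>U. g x \<noteq> c} \<le> card U + m" by simp
  then show ?thesis using reach_trans[OF reach_trans[OF 1 2] 3] reach_mono by blast
qed

lemma reach_of_small_color_sets:
  assumes fin: "finite (V :: 'v set)" and card3: "\<And>T. T \<in> H \<Longrightarrow> card T = 3"
    and V7: "card V \<le> 7"
    and base3: "\<And>S (K :: 'c set) f g. S \<subseteq> V \<Longrightarrow> card K = 3 \<Longrightarrow> f ` S \<subseteq> K \<Longrightarrow> g ` S \<subseteq> K \<Longrightarrow>
      proper H S f \<Longrightarrow> proper H S g \<Longrightarrow> reach H S K (card S + 1) f g"
    and base4: "\<And>S (K :: 'c set) f g. S \<subseteq> V \<Longrightarrow> card S \<ge> 6 \<Longrightarrow> card K = 4 \<Longrightarrow> 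
      f ` S \<subseteq> K \<Longrightarrow> g ` S \<subseteq> K \<Longrightarrow> proper H S f \<Longrightarrow> proper H S g \<Longrightarrow>
      (\<And>c. c \<in> K \<Longrightarrow> \<exists>T\<in>H. T \<subseteq> {x\<in>S. f x = c \<or> g x = c}) \<Longrightarrow> reach H S K (card S + 1) f g"
    and "S \<subseteq> V" "card K \<ge> 3" "f ` S \<subseteq> K" "g ` S \<subseteq> K" "proper H S f" "proper H S g"
  shows "reach H S (K :: 'c set) (card S + 1) f g"
  using assms(6-)
proof (induction "card K" arbitrary: K S)
  case (Suc k)
  have finS: "finite S" using finite_subset[OF Suc.prems(1) fin] .
  have finK: "finite K" using Suc.hyps(2) card_ge_0_finite[of K] by simp
  show ?case
  proof (cases "card K = 3")
    case False
    show ?thesis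
    proof (cases "\<exists>c\<in>K. \<not> (\<exists>T\<in>H. T \<subseteq> {x\<in>S. f x = c \<or> g x = c})")
      case True
      then obtain c where c: "c \<in> K" "\<not> (\<exists>T\<in>H. T \<subseteq> {x\<in>S. f x = c \<or> g x = c})" by blast
      define U where "U = {x\<in>S. f x = c \<or> g x = c}"
      have sub: "proper H (S - U) f" "proper H (S - U) g"
        using Suc.prems(5,6) proper_mono[OF _ Diff_subset] by blast+
      have "reach H (S - U) (K - {c}) (card (S - U) + 1) f g"
        using Suc.prems Suc.hyps(2) False c(1) finK
        by (intro Suc.hyps(1)) (auto simp: U_def sub[unfolded U_def])
      then have "reach H S K (card U + (card (S - U) + 1)) f g"
        using c(2) by (intro reach_remove_class[OF finS c(1) Suc.prems(5,6,3,4) U_def])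
          (simp_all add: U_def)
      moreover have "card U + card (S - U) = card S"
        using card_Un_disjoint[of U "S - U"] finS by (simp add: U_def Un_absorb1)
      ultimately show ?thesis by (simp only: add.assoc[symmetric])
    next
      case False
      then have big: "\<exists>T\<in>H. T \<subseteq> {x\<in>S. f x = c \<or> g x = c}" if "c \<in> K" for c using that by blast
      have sum: "(\<Sum>c\<in>K. card {x\<in>S. h x = c}) = card S" if "h ` S \<subseteq> K" for h
        using sum.group[OF finS finK that, of "\<lambda>_. 1 :: nat"] by simp
      have "3 \<le> card {x\<in>S. f x = c} + card {x\<in>S. g x = c}" if c: "c \<in> K" for c
      proof -
        obtain T where T: "T \<in> H" "T \<subseteq> {x\<in>S. f x = c \<or> g x = c}" using big[OF c] by blast
        then have "3 \<le> card {x\<in>S. f x = c \<or> g x = c}"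
          using card_mono[OF _ T(2)] card3[OF T(1)] finS by simp
        also have "{x\<in>S. f x = c \<or> g x = c} = {x\<in>S. f x = c} \<union> {x\<in>S. g x = c}" by auto
        finally show ?thesis using card_Un_le[of "{x\<in>S. f x = c}" "{x\<in>S. g x = c}"] by linarith
      qed
      then have "(\<Sum>c\<in>K. 3) \<le> (\<Sum>c\<in>K. card {x\<in>S. f x = c} + card {x\<in>S. g x = c})"
        by (rule sum_mono)
      also have "\<dots> = 2 * card S" using Suc.prems by (simp add: sum.distrib sum)
      finally have le: "3 * card K \<le> 2 * card S" by simp
      moreover have "card S \<le> 7" using V7 card_mono[OF fin Suc.prems(1)] by simp
      ultimately have "card K = 4" "card S \<ge> 6"
        using Suc.prems(2) \<open>card K \<noteq> 3\<close> by presburger+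
      then show ?thesis using big by (intro base4[OF Suc.prems(1) _ _ Suc.prems(3-6)])
    qed
  next
    case True
    then show ?thesis by (rule base3[OF Suc.prems(1) _ Suc.prems(3-6)])
  qed
qed simp

section \<open>Evaluation of the finite cases\<close>

text \<open>A value of type \<open>cfg\<close> is a partial coloring of the seven vertices; \<open>Blank\<close> marks the vertices
  outside the vertex set under consideration. The functions below use \<open>if\<close> in place of the logical
  connectives, and partially applied constants in place of abstractions, since the simplifier evaluates
  the arguments of connectives and the bodies of abstractions eagerly.\<close>

datatype vx = V0 | V1 | V2 | V3 | V4 | V5 | V6

datatype col = Blank | A | B | C | D

datatype cfg = Cfg col col col col col col col

fun look :: "cfg \<Rightarrow> vx \<Rightarrow> col" where
  "look (Cfg a b c d e f g) V0 = a"
| "look (Cfg a b c d e f g) V1 = b"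
| "look (Cfg a b c d e f g) V2 = c"
| "look (Cfg a b c d e f g) V3 = d"
| "look (Cfg a b c d e f g) V4 = e"
| "look (Cfg a b c d e f g) V5 = f"
| "look (Cfg a b c d e f g) V6 = g"

fun put :: "cfg \<Rightarrow> vx \<Rightarrow> col \<Rightarrow> cfg" where
  "put (Cfg a b c d e f g) V0 x = Cfg x b c d e f g"
| "put (Cfg a b c d e f g) V1 x = Cfg a x c d e f g"
| "put (Cfg a b c d e f g) V2 x = Cfg a b x d e f g"
| "put (Cfg a b c d e f g) V3 x = Cfg a b c x e f g"
| "put (Cfg a b c d e f g) V4 x = Cfg a b c d x f g"
| "put (Cfg a b c d e f g) V5 x = Cfg a b c d e x g"
| "put (Cfg a b c d e f g) V6 x = Cfg a b c d e f x"

definition vxs :: "vx list" where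
  "vxs = [V0, V1, V2, V3, V4, V5, V6]"

definition blank :: cfg where
  "blank = Cfg Blank Blank Blank Blank Blank Blank Blank"

fun links :: "vx \<Rightarrow> (vx \<times> vx) list" where
  "links V0 = [(V1,V3),(V1,V5),(V2,V3),(V2,V6),(V4,V5),(V4,V6)]"
| "links V1 = [(V0,V3),(V0,V5),(V2,V4),(V2,V6),(V3,V4),(V5,V6)]"
| "links V2 = [(V0,V3),(V0,V6),(V1,V4),(V1,V6),(V3,V5),(V4,V5)]"
| "links V3 = [(V0,V1),(V0,V2),(V1,V4),(V2,V5),(V4,V6),(V5,V6)]"
| "links V4 = [(V0,V5),(V0,V6),(V1,V2),(V1,V3),(V2,V5),(V3,V6)]"
| "links V5 = [(V0,V1),(V0,V4),(V1,V6),(V2,V3),(V2,V4),(V3,V6)]"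
| "links V6 = [(V0,V2),(V0,V4),(V1,V2),(V1,V5),(V3,V4),(V3,V5)]"

definition triangles :: "(vx \<times> vx \<times> vx) list" where
  "triangles =
    [(V0,V1,V3),(V0,V1,V5),(V0,V2,V3),(V0,V2,V6),(V0,V4,V5),(V0,V4,V6),(V1,V2,V4),
     (V1,V2,V6),(V1,V3,V4),(V1,V5,V6),(V2,V3,V5),(V2,V4,V5),(V3,V4,V6),(V3,V5,V6)]"

primrec some_of :: "('a \<Rightarrow> bool) \<Rightarrow> 'a list \<Rightarrow> bool" where
  "some_of P [] = False"
| "some_of P (x # xs) = (if P x then True else some_of P xs)"

primrec every :: "('a \<Rightarrow> bool) \<Rightarrow> 'a list \<Rightarrow> bool" where
  "every P [] = True"
| "every P (x # xs) = (if P x then every P xs else False)"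

text \<open>The six pairs that form a cyclic triangle with a given vertex are the edges of a hexagon on
  the other six vertices. The arguments \<open>p\<close>, ..., \<open>u\<close> are the colors around this hexagon, and the result
  says whether the vertex in its center may get color \<open>x\<close>.\<close>

definition hexagon :: "col \<Rightarrow> col \<Rightarrow> col \<Rightarrow> col \<Rightarrow> col \<Rightarrow> col \<Rightarrow> col \<Rightarrow> bool" where
  "hexagon x p q r s t u = (if x = Blank then True else
     if p = x then
       if q = x then False else if u = x then False else
       if s = x then if r = x then False else t \<noteq> x else True
     else if q = x then
       if r = x then False else
       if t = x then if s = x then False else u \<noteq> x else True
     else if s = x then if r = x then False else t \<noteq> x
     else if t = x then u \<noteq> x else True)"

fun fits :: "cfg \<Rightarrow> vx \<Rightarrow> col \<Rightarrow> bool" where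
  "fits (Cfg a b c d e f g) V0 x = hexagon x b d c g e f"
| "fits (Cfg a b c d e f g) V1 x = hexagon x a d e c g f"
| "fits (Cfg a b c d e f g) V2 x = hexagon x a d f e b g"
| "fits (Cfg a b c d e f g) V3 x = hexagon x a b e g f c"
| "fits (Cfg a b c d e f g) V4 x = hexagon x a f c b d g"
| "fits (Cfg a b c d e f g) V5 x = hexagon x a b g d c e"
| "fits (Cfg a b c d e f g) V6 x = hexagon x a c b f d e"

definition valid :: "cfg \<Rightarrow> bool" where
  "valid f = every (\<lambda>v. fits f v (look f v)) vxs"

primrec differences :: "cfg \<Rightarrow> cfg \<Rightarrow> vx list \<Rightarrow> nat" where
  "differences f g [] = 0"
| "differences f g (v # ws) =
     (if look f v = look g v then differences f g ws else Suc (differences f g ws))"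

primrec direct :: "nat \<Rightarrow> cfg \<Rightarrow> cfg \<Rightarrow> bool" where
  "direct 0 f g = (f = g)"
| "direct (Suc n) f g = some_of (\<lambda>v. let c = look g v in
     if look f v = c then False else if fits f v c then direct n (put f v c) g else False) vxs"

text \<open>\<open>n\<close> arbitrary recolorings, followed by at most \<open>m\<close> that give each remaining vertex its final
  color directly. In all cases that occur, \<open>n \<le> 2\<close> is enough.\<close>

primrec detour :: "nat \<Rightarrow> nat \<Rightarrow> col list \<Rightarrow> cfg \<Rightarrow> cfg \<Rightarrow> bool" where
  "detour 0 m cs f g = (let h = differences f g vxs in if h \<le> m then direct h f g else False)"
| "detour (Suc n) m cs f g = some_of (\<lambda>v. let d = look f v in if d = Blank then False else
      some_of (\<lambda>c. if c = d then False else if fits f v c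
         then detour n m cs (put f v c) g else False) cs) vxs"

definition solve :: "col list \<Rightarrow> cfg \<Rightarrow> cfg \<Rightarrow> bool" where
  "solve cs f g = (let m = differences f blank vxs in
     if detour 0 (Suc m) cs f g then True else if detour (Suc 0) m cs f g then True
     else case m of 0 \<Rightarrow> False | Suc m' \<Rightarrow> detour (Suc (Suc 0)) m' cs f g)"

primrec every_fit :: "cfg \<Rightarrow> vx \<Rightarrow> (cfg \<Rightarrow> bool) \<Rightarrow> col list \<Rightarrow> bool" where
  "every_fit p v k [] = True"
| "every_fit p v k (c # cs) = (if (if fits p v c then k (put p v c) else True)
     then every_fit p v k cs else False)"

primrec extensions ::
    "(cfg \<Rightarrow> vx \<Rightarrow> col list) \<Rightarrow> (cfg \<Rightarrow> bool) \<Rightarrow> vx list \<Rightarrow> cfg \<Rightarrow> bool" where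
  "extensions ch P [] p = P p"
| "extensions ch P (v # ws) p = every_fit p v (extensions ch P ws) (ch p v)"

fun lt :: "col \<Rightarrow> col \<Rightarrow> bool" where
  "lt _ Blank = False"
| "lt Blank _ = True"
| "lt _ A = False"
| "lt A _ = True"
| "lt _ B = False"
| "lt B _ = True"
| "lt _ C = False"
| "lt C _ = True"
| "lt D D = False"

fun smaller :: "cfg \<Rightarrow> cfg \<Rightarrow> vx list \<Rightarrow> bool" where
  "smaller f g [] = False"
| "smaller f g (v # ws) = (let a = look f v; b = look g v in
     if a = b then smaller f g ws else lt a b)"

fun recolor :: "(col \<Rightarrow> col) \<Rightarrow> cfg \<Rightarrow> cfg" where
  "recolor s (Cfg a b c d e f g) = Cfg (s a) (s b) (s c) (s d) (s e) (s f) (s g)"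

definition swap :: "col \<Rightarrow> col \<Rightarrow> col \<Rightarrow> col" where
  "swap x y z = (if z = x then y else if z = y then x else z)"

fun normalize :: "vx list \<Rightarrow> col list \<Rightarrow> cfg \<Rightarrow> cfg" where
  "normalize (v # ws) (m # ms) t = (let c = look t v in if lt c m then normalize ws (m # ms) t
     else normalize ws ms (if c = m then t else recolor (swap c m) t))"
| "normalize _ _ t = t"

fun rotate_cfg :: "cfg \<Rightarrow> cfg" where
  "rotate_cfg (Cfg a b c d e f g) = Cfg b c d e f g a"

fun double_cfg :: "cfg \<Rightarrow> cfg" where
  "double_cfg (Cfg a b c d e f g) = Cfg a c e g b d f"

primrec rotation_smaller :: "col list \<Rightarrow> nat \<Rightarrow> cfg \<Rightarrow> cfg \<Rightarrow> bool" where
  "rotation_smaller cs 0 s t = False"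
| "rotation_smaller cs (Suc n) s t = (if smaller (normalize vxs cs s) t vxs then True
     else rotation_smaller cs n (rotate_cfg s) t)"

text \<open>A configuration may be skipped if one of its 21 images under the automorphisms becomes
  lexicographically smaller once the colors are renamed in order of first appearance.\<close>

definition reducible :: "col list \<Rightarrow> cfg \<Rightarrow> bool" where
  "reducible cs t = (if rotation_smaller cs 7 t t then True
     else let s = double_cfg t in if rotation_smaller cs 7 s t then True
     else rotation_smaller cs 7 (double_cfg s) t)"

definition fill :: "col list \<Rightarrow> cfg \<Rightarrow> cfg \<Rightarrow> vx \<Rightarrow> col list" where
  "fill cs f p v = (if look p v \<noteq> Blank then [look p v] else if look f v = Blank then [Blank] else cs)"

text \<open>For each color \<open>c\<close>, \<open>cover\<close> guesses a cyclic triangle inside the set of vertices colored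
  \<open>c\<close> by \<open>f\<close> or by the target coloring; the vertices of the triangle not colored \<open>c\<close> by
  \<open>f\<close> are then fixed in the partial target \<open>p\<close>.\<close>

definition claim :: "cfg \<Rightarrow> col \<Rightarrow> vx \<Rightarrow> (cfg \<Rightarrow> bool) \<Rightarrow> cfg \<Rightarrow> bool" where
  "claim f c v k p = (if look f v = c then k p else if look f v = Blank then True
     else if look p v = Blank then k (put p v c) else if look p v = c then k p else True)"

primrec claim_triangles ::
    "cfg \<Rightarrow> col \<Rightarrow> (cfg \<Rightarrow> bool) \<Rightarrow> cfg \<Rightarrow> (vx \<times> vx \<times> vx) list \<Rightarrow> bool" where
  "claim_triangles f c k p [] = True"
| "claim_triangles f c k p (T # Ts) =
     (if case T of (x, y, z) \<Rightarrow> claim f c x (claim f c y (claim f c z k)) p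
      then claim_triangles f c k p Ts else False)"

primrec cover :: "cfg \<Rightarrow> (cfg \<Rightarrow> bool) \<Rightarrow> col list \<Rightarrow> cfg \<Rightarrow> bool" where
  "cover f P [] p = P p"
| "cover f P (c # cs) p = claim_triangles f c (cover f P cs) p triangles"

definition direct_if_valid :: "cfg \<Rightarrow> cfg \<Rightarrow> bool" where
  "direct_if_valid f g = (if valid g then direct (differences f g vxs) f g else True)"

definition check3 :: "cfg \<Rightarrow> bool" where
  "check3 f = (if reducible [A, B, C] f then True
     else extensions (fill [A, B, C] f) (solve [A, B, C] f) vxs blank)"

definition check4 :: "cfg \<Rightarrow> bool" where
  "check4 f = (if some_of (\<lambda>c. every (\<lambda>v. look f v \<noteq> c) vxs) [A, B, C, D] then True
     else if reducible [A, B, C, D] f then True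
     else cover f (extensions (fill [A, B, C, D] f) (direct_if_valid f) vxs) [A, B, C, D] blank)"

text \<open>By symmetry, the first nonblank vertex may be assumed to have color \<open>A\<close>, and a single blank vertex
  to be \<open>V0\<close>.\<close>

definition first_choice :: "cfg \<Rightarrow> vx \<Rightarrow> col list" where
  "first_choice p v = (if v = V0 then [Blank, A] else [Blank, A, B, C])"

definition full_choice :: "cfg \<Rightarrow> vx \<Rightarrow> col list" where
  "full_choice p v = (if v = V0 then [A] else [A, B, C, D])"

definition blank_choice :: "cfg \<Rightarrow> vx \<Rightarrow> col list" where
  "blank_choice p v = (if v = V0 then [Blank] else if v = V1 then [A] else [A, B, C, D])"

lemma all_check3: "extensions first_choice check3 vxs blank"
  by code_simp

lemma all_check4: "extensions full_choice check4 vxs blank"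
  by code_simp

lemma all_check4_blank: "extensions blank_choice check4 vxs blank"
  by code_simp

section \<open>Soundness of the evaluation\<close>

definition supp :: "cfg \<Rightarrow> vx set" where
  "supp f = {v. look f v \<noteq> Blank}"

definition Tri :: "vx set set" where
  "Tri = {{v, a, b} | v a b. (a, b) \<in> set (links v)}"

lemma some_of_iff [simp]: "some_of P xs \<longleftrightarrow> (\<exists>x\<in>set xs. P x)"
  by (induction xs) auto

lemma every_iff [simp]: "every P xs \<longleftrightarrow> (\<forall>x\<in>set xs. P x)"
  by (induction xs) auto

lemma set_vxs [simp]: "set vxs = UNIV"
  using vx.exhaust by (auto simp: vxs_def)

instance vx :: finite
  by standard (metis List.finite_set set_vxs)

lemma look_put: "look (put f v c) = (look f)(v := c)"
proof
  fix w show "look (put f v c) w = ((look f)(v := c)) w"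
    by (cases f; cases v; cases w) simp_all
qed

lemma distinct_vxs: "distinct vxs"
  by (simp add: vxs_def)

lemma cfg_eqI:
  assumes "look f = look g"
  shows "f = g"
proof -
  have "look f v = look g v" for v using assms by simp
  from this[of V0] this[of V1] this[of V2] this[of V3] this[of V4] this[of V5] this[of V6]
  show ?thesis by (cases f; cases g) simp
qed

lemma every_fit_iff [simp]:
  "every_fit p v k cs \<longleftrightarrow> (\<forall>c\<in>set cs. fits p v c \<longrightarrow> k (put p v c))"
  by (induction cs) auto

lemma claim_triangles_iff [simp]:
  "claim_triangles f c k p Ts \<longleftrightarrow> (\<forall>(x, y, z)\<in>set Ts. claim f c x (claim f c y (claim f c z k)) p)"
  by (induction Ts) auto

lemma fits_iff:
  "fits f v c \<longleftrightarrow> c = Blank \<or> (\<forall>a b. (a, b) \<in> set (links v) \<longrightarrow> \<not> (look f a = c \<and> look f b = c))"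
proof -
  have "fits f v c \<longleftrightarrow> c = Blank \<or> (\<forall>(a, b)\<in>set (links v). \<not> (look f a = c \<and> look f b = c))"
    by (cases f; cases v) (auto simp: hexagon_def)
  then show ?thesis by fast
qed

lemma valid_iff:
  "valid f \<longleftrightarrow> (\<forall>v a b. (a, b) \<in> set (links v) \<longrightarrow> look f v \<noteq> Blank \<longrightarrow>
     \<not> (look f a = look f v \<and> look f b = look f v))"
  unfolding valid_def by (auto simp: fits_iff)

lemma valid_iff_proper: "valid f \<longleftrightarrow> proper Tri (supp f) (look f)"
proof
  assume f: "valid f"
  show "proper Tri (supp f) (look f)"
    unfolding proper_def
  proof (intro ballI impI notI, elim exE)
    fix T c assume T: "T \<in> Tri" "T \<subseteq> supp f" "\<forall>x\<in>T. look f x = c"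
    then obtain v a b where "(a, b) \<in> set (links v)" "T = {v, a, b}"
      unfolding Tri_def by blast
    then show False using f T(2,3) unfolding valid_iff supp_def by auto
  qed
next
  assume f: "proper Tri (supp f) (look f)"
  show "valid f"
    unfolding valid_iff
  proof (intro allI impI notI)
    fix v a b assume *: "(a, b) \<in> set (links v)" "look f v \<noteq> Blank"
      "look f a = look f v \<and> look f b = look f v"
    then have "{v, a, b} \<in> Tri" "{v, a, b} \<subseteq> supp f" unfolding Tri_def supp_def by auto
    then show False using f * unfolding proper_def by (metis insertE singletonD)
  qed
qed

lemma links_rotate:
  assumes "(a, b) \<in> set (links v)"
  shows "a \<noteq> v" "b \<noteq> v" "(v, b) \<in> set (links a) \<or> (b, v) \<in> set (links a)"
    "(v, a) \<in> set (links b) \<or> (a, v) \<in> set (links b)"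
  using assms by (cases v; auto)+

lemma valid_put:
  assumes "valid f" "fits f v c"
  shows "valid (put f v c)"
  unfolding valid_iff look_put
proof (intro allI impI notI)
  fix w a b
  assume *: "(a, b) \<in> set (links w)" "((look f)(v := c)) w \<noteq> Blank"
    "((look f)(v := c)) a = ((look f)(v := c)) w \<and> ((look f)(v := c)) b = ((look f)(v := c)) w"
  note r = links_rotate[OF *(1)]
  consider "v = w" | "v = a" | "v = b" | "v \<notin> {w, a, b}" by blast
  then show False
  proof cases
    case 1
    then show False using * r(1,2) assms(2) unfolding fits_iff by auto
  next
    case 2
    then have "c \<noteq> Blank" "look f w = c" using * r(1) by auto
    moreover have "look f b = c" using * r links_rotate(1,2)[of _ _ a] 2 by (auto split: if_splits)
    ultimately show False using r(3) 2 assms(2) unfolding fits_iff by blast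
  next
    case 3
    then have "c \<noteq> Blank" "look f w = c" using * r(2) by auto
    moreover have "look f a = c" using * r links_rotate(1,2)[of _ _ b] 3 by (auto split: if_splits)
    ultimately show False using r(4) 3 assms(2) unfolding fits_iff by blast
  next
    case 4
    then show False using * assms(1) unfolding valid_iff by auto
  qed
qed

lemma supp_put: "v \<in> supp f \<Longrightarrow> c \<noteq> Blank \<Longrightarrow> supp (put f v c) = supp f"
  unfolding supp_def look_put by auto

lemma reach_put:
  assumes "valid f" "fits f v c" "v \<in> supp f" "c \<noteq> Blank" "c \<in> K"
    "reach Tri (supp f) K n (look (put f v c)) g"
  shows "reach Tri (supp f) K (Suc n) (look f) g"
proof -
  have "proper Tri (supp f) ((look f)(v := c))"
    using valid_put[OF assms(1,2)] assms(3,4) by (simp add: valid_iff_proper supp_put look_put)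
  then show ?thesis unfolding reach.simps using assms(3,5,6) unfolding look_put by blast
qed

lemma direct_sound:
  assumes "direct n f g" "valid f" "supp f = supp g" "look g ` supp g \<subseteq> K"
  shows "reach Tri (supp f) K n (look f) (look g)"
  using assms
proof (induction n arbitrary: f)
  case (Suc n)
  then obtain v where v: "look f v \<noteq> look g v" "fits f v (look g v)" "direct n (put f v (look g v)) g"
    by (auto simp: Let_def split: if_splits)
  then have s: "v \<in> supp f" "look g v \<noteq> Blank" using Suc.prems(3) unfolding supp_def by force+
  then have "look g v \<in> K" using Suc.prems(3,4) by auto
  moreover have "reach Tri (supp f) K n (look (put f v (look g v))) (look g)"
    using Suc.IH[OF v(3) valid_put[OF Suc.prems(2) v(2)]] Suc.prems(3,4) supp_put[OF s] by simp
  ultimately show ?case using reach_put Suc.prems(2) v(2) s by blast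
qed (simp add: reach_refl)

lemma detour_sound:
  assumes "detour n m cs f g" "valid f" "supp f = supp g" "look g ` supp g \<subseteq> set cs" "Blank \<notin> set cs"
  shows "reach Tri (supp f) (set cs) (n + m) (look f) (look g)"
  using assms
proof (induction n arbitrary: f)
  case 0
  then have "direct (differences f g vxs) f g" "differences f g vxs \<le> 0 + m"
    by (simp_all add: Let_def split: if_splits)
  then show ?case using direct_sound[OF _ 0(2-4)] reach_mono by blast
next
  case (Suc n)
  then obtain v c where v: "look f v \<noteq> Blank" "c \<in> set cs" "fits f v c"
      "detour n m cs (put f v c) g"
    by (auto simp: Let_def split: if_splits)
  then have s: "v \<in> supp f" "c \<noteq> Blank" using Suc.prems(5) unfolding supp_def by auto
  have "reach Tri (supp f) (set cs) (n + m) (look (put f v c)) (look g)"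
    using Suc.IH[OF v(4) valid_put[OF Suc.prems(2) v(3)]] Suc.prems(3-5) supp_put[OF s] by simp
  then show ?case using reach_put Suc.prems(2) v(2,3) s by simp
qed

lemma differences_blank: "distinct ws \<Longrightarrow> differences f blank ws = card (set ws \<inter> supp f)"
proof (induction ws)
  case (Cons v ws)
  have "look blank v = Blank" by (cases v) (simp_all add: blank_def)
  then show ?case using Cons by (auto simp: supp_def Int_insert_left)
qed simp

lemma solve_sound:
  assumes "solve cs f g" "valid f" "supp f = supp g" "look g ` supp g \<subseteq> set cs" "Blank \<notin> set cs"
  shows "reach Tri (supp f) (set cs) (card (supp f) + 1) (look f) (look g)"
proof -
  have d: "differences f blank vxs = card (supp f)"
    using differences_blank[OF distinct_vxs, of f] by simp
  have "\<exists>n m. n + m \<le> card (supp f) + 1 \<and> detour n m cs f g"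
  proof -
    let ?m = "card (supp f)"
    consider "detour 0 (Suc ?m) cs f g" | "detour (Suc 0) ?m cs f g"
      | m where "?m = Suc m" "detour (Suc (Suc 0)) m cs f g"
      using assms(1) unfolding solve_def d Let_def
      by (auto simp del: detour.simps split: if_splits nat.splits)
    then show ?thesis
    proof cases
      case 1
      then show ?thesis by (intro exI[of _ 0] exI[of _ "Suc ?m"]) simp
    next
      case 2
      then show ?thesis by (intro exI[of _ "Suc 0"] exI[of _ ?m]) simp
    next
      case (3 m)
      then show ?thesis by (intro exI[of _ "Suc (Suc 0)"] exI[of _ m]) simp
    qed
  qed
  then show ?thesis using detour_sound[OF _ assms(2-5)] reach_mono by blast
qed

definition extends :: "cfg \<Rightarrow> cfg \<Rightarrow> bool" where
  "extends p g \<longleftrightarrow> (\<forall>v. look p v \<noteq> Blank \<longrightarrow> look p v = look g v)"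

lemma extends_blank: "extends blank g"
proof -
  have "look blank v = Blank" for v by (cases v) (simp_all add: blank_def)
  then show ?thesis by (simp add: extends_def)
qed

lemma extends_put: "extends p g \<Longrightarrow> extends (put p v (look g v)) g"
  by (simp add: extends_def look_put)

lemma extensions_sound:
  assumes "extensions ch P ws p" "valid g" "extends p g" "\<And>v. v \<notin> set ws \<Longrightarrow> look p v = look g v"
    "\<And>p v. extends p g \<Longrightarrow> look g v \<in> set (ch p v)"
  shows "P g"
  using assms(1,3,4)
proof (induction ws arbitrary: p)
  case Nil
  then show ?case using cfg_eqI[of p g] by auto
next
  case (Cons v ws)
  have "fits p v (look g v)"
    using assms(2) Cons.prems(2) unfolding valid_iff fits_iff extends_def by metis
  then have "extensions ch P ws (put p v (look g v))"
    using Cons.prems(1) assms(5)[OF Cons.prems(2), of v] by auto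
  then show ?case
    by (rule Cons.IH) (use Cons.prems(2,3) extends_put in \<open>auto simp: look_put\<close>)
qed

lemma claim_sound:
  assumes "claim f c v k p" "extends p g" "v \<in> {v\<in>supp f. look f v = c \<or> look g v = c}"
    "c \<noteq> Blank"
  obtains p' where "extends p' g" "k p'"
proof -
  have "\<exists>p'. extends p' g \<and> k p'"
    using assms extends_put[of p g v] unfolding claim_def supp_def extends_def
    by (auto split: if_splits)
  then show thesis using that by blast
qed

definition covers :: "cfg \<Rightarrow> cfg \<Rightarrow> col \<Rightarrow> bool" where
  "covers f g c \<longleftrightarrow> (\<exists>T\<in>Tri. T \<subseteq> {v\<in>supp f. look f v = c \<or> look g v = c})"

lemma Tri_eq: "Tri = (\<lambda>(x, y, z). {x, y, z}) ` set triangles"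
proof
  have "{v, a, b} \<in> (\<lambda>(x, y, z). {x, y, z}) ` set triangles" if ab: "(a, b) \<in> set (links v)" for v a b
  proof -
    have "(v, a, b) \<in> set triangles \<or> (a, v, b) \<in> set triangles \<or> (a, b, v) \<in> set triangles"
      using ab by (cases v) (auto simp: triangles_def)
    moreover have "{v, a, b} = {a, v, b}" "{v, a, b} = {a, b, v}" by blast+
    ultimately show ?thesis by (metis (mono_tags, lifting) case_prod_conv image_eqI)
  qed
  then show "Tri \<subseteq> (\<lambda>(x, y, z). {x, y, z}) ` set triangles"
    unfolding Tri_def by auto
  have "(y, z) \<in> set (links x)" if "(x, y, z) \<in> set triangles" for x y z
    using that by (auto simp: triangles_def)
  then show "(\<lambda>(x, y, z). {x, y, z}) ` set triangles \<subseteq> Tri"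
    unfolding Tri_def by (clarsimp, metis)
qed

lemma cover_sound:
  assumes "cover f P cs p" "extends p g" "\<And>c. c \<in> set cs \<Longrightarrow> covers f g c" "Blank \<notin> set cs"
  shows "\<exists>p'. extends p' g \<and> P p'"
  using assms
proof (induction cs arbitrary: p)
  case (Cons c cs)
  have "covers f g c" using Cons.prems(3) by simp
  then obtain x y z where t: "(x, y, z) \<in> set triangles"
    "{x, y, z} \<subseteq> {v\<in>supp f. look f v = c \<or> look g v = c}"
    unfolding covers_def Tri_eq by (auto simp: subset_iff)
  have c: "c \<noteq> Blank" using Cons.prems(4) by auto
  have v: "x \<in> {v\<in>supp f. look f v = c \<or> look g v = c}"
    "y \<in> {v\<in>supp f. look f v = c \<or> look g v = c}"
    "z \<in> {v\<in>supp f. look f v = c \<or> look g v = c}" using t(2) by auto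
  have "claim f c x (claim f c y (claim f c z (cover f P cs))) p"
    using Cons.prems(1) t(1) by auto
  from claim_sound[OF this Cons.prems(2) v(1) c]
  obtain p1 where 1: "extends p1 g" "claim f c y (claim f c z (cover f P cs)) p1" .
  from claim_sound[OF 1(2,1) v(2) c]
  obtain p2 where 2: "extends p2 g" "claim f c z (cover f P cs) p2" .
  from claim_sound[OF 2(2,1) v(3) c]
  obtain p3 where "extends p3 g" "cover f P cs p3" .
  then show ?case using Cons.IH[of p3] Cons.prems(3,4) by simp
qed auto

section \<open>Symmetries\<close>

definition comparable :: "col list \<Rightarrow> cfg \<Rightarrow> cfg \<Rightarrow> bool" where
  "comparable cs f g \<longleftrightarrow> valid f \<and> valid g \<and> supp f = supp g \<and>
     look f ` supp f \<subseteq> set cs \<and> look g ` supp g \<subseteq> set cs"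

definition short_path :: "col list \<Rightarrow> cfg \<Rightarrow> cfg \<Rightarrow> bool" where
  "short_path cs f g \<longleftrightarrow> 
     (length cs = 4 \<longrightarrow> 6 \<le> card (supp f) \<and> (\<forall>c\<in>set cs. covers f g c)) \<longrightarrow>
     reach Tri (supp f) (set cs) (card (supp f) + 1) (look f) (look g)"

inductive symmetry :: "col list \<Rightarrow> (cfg \<Rightarrow> cfg) \<Rightarrow> bool" for cs where
  identity: "symmetry cs (\<lambda>f. f)"
| recolor: "symmetry cs t \<Longrightarrow> x \<in> set cs \<Longrightarrow> y \<in> set cs \<Longrightarrow>
    symmetry cs (\<lambda>f. recolor (swap x y) (t f))"
| rotate: "symmetry cs t \<Longrightarrow> symmetry cs (\<lambda>f. rotate_cfg (t f))"
| double: "symmetry cs t \<Longrightarrow> symmetry cs (\<lambda>f. double_cfg (t f))"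

lemma look_recolor: "look (recolor s f) = s \<circ> look f"
proof
  show "look (recolor s f) v = (s \<circ> look f) v" for v by (cases f; cases v) simp_all
qed

fun next_vx :: "vx \<Rightarrow> vx" where
  "next_vx V0 = V1" | "next_vx V1 = V2" | "next_vx V2 = V3" | "next_vx V3 = V4"
| "next_vx V4 = V5" | "next_vx V5 = V6" | "next_vx V6 = V0"

fun double_vx :: "vx \<Rightarrow> vx" where
  "double_vx V0 = V0" | "double_vx V1 = V2" | "double_vx V2 = V4" | "double_vx V3 = V6"
| "double_vx V4 = V1" | "double_vx V5 = V3" | "double_vx V6 = V5"

lemma look_rotate: "look (rotate_cfg f) = look f \<circ> next_vx"
proof
  show "look (rotate_cfg f) v = (look f \<circ> next_vx) v" for v by (cases f; cases v) simp_all
qed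

lemma look_double: "look (double_cfg f) = look f \<circ> double_vx"
proof
  show "look (double_cfg f) v = (look f \<circ> double_vx) v" for v by (cases f; cases v) simp_all
qed

lemma bij_vx:
  assumes "inj (p :: vx \<Rightarrow> vx)"
    "\<And>v a b. (a, b) \<in> set (links v) \<Longrightarrow>
      (p a, p b) \<in> set (links (p v)) \<or> (p b, p a) \<in> set (links (p v))"
  shows "bij p" "(`) p ` Tri = Tri"
proof -
  show "bij p" using assms(1) by (simp add: bij_def finite_UNIV_inj_surj)
  have "p ` T \<in> Tri" if "T \<in> Tri" for T
  proof -
    obtain v a b where *: "T = {v, a, b}" "(a, b) \<in> set (links v)"
      using \<open>T \<in> Tri\<close> unfolding Tri_def by blast
    have eq: "p ` T = {p v, p a, p b}" "p ` T = {p v, p b, p a}" unfolding * by auto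
    from assms(2)[OF *(2)] show ?thesis
    proof
      assume "(p a, p b) \<in> set (links (p v))"
      then show ?thesis unfolding eq(1) Tri_def by blast
    next
      assume "(p b, p a) \<in> set (links (p v))"
      then show ?thesis unfolding eq(2) Tri_def by blast
    qed
  qed
  moreover have "finite Tri" by (simp add: Tri_eq)
  moreover have "inj_on ((`) p) Tri" using inj_image_eq_iff[OF assms(1)] by (auto intro: inj_onI)
  ultimately show "(`) p ` Tri = Tri" by (intro endo_inj_surj) auto
qed

lemma symmetry_next: "bij next_vx" "(`) next_vx ` Tri = Tri"
proof -
  have inj: "inj next_vx"
  proof (rule injI)
    show "x = y" if "next_vx x = next_vx y" for x y using that by (cases x; cases y) simp_all
  qed
  have links: "(next_vx a, next_vx b) \<in> set (links (next_vx v)) \<or>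
      (next_vx b, next_vx a) \<in> set (links (next_vx v))" if "(a, b) \<in> set (links v)" for a b v
    using that by (cases v; simp; elim disjE conjE; simp)
  show "bij next_vx" "(`) next_vx ` Tri = Tri" by (simp_all add: bij_vx[OF inj links])
qed

lemma symmetry_double: "bij double_vx" "(`) double_vx ` Tri = Tri"
proof -
  have inj: "inj double_vx"
  proof (rule injI)
    show "x = y" if "double_vx x = double_vx y" for x y using that by (cases x; cases y) simp_all
  qed
  have links: "(double_vx a, double_vx b) \<in> set (links (double_vx v)) \<or>
      (double_vx b, double_vx a) \<in> set (links (double_vx v))" if "(a, b) \<in> set (links v)" for a b v
    using that by (cases v; simp; elim disjE conjE; simp)
  show "bij double_vx" "(`) double_vx ` Tri = Tri" by (simp_all add: bij_vx[OF inj links])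
qed

lemma vertex_symmetry:
  assumes p: "bij p" "(`) p ` Tri = Tri"
    and look: "look f' = look f \<circ> p" "look g' = look g \<circ> p"
    and fg: "comparable cs f g"
  shows "comparable cs f' g'" "short_path cs f' g' \<Longrightarrow> short_path cs f g"
proof -
  have supp: "p ` supp f' = supp f" "p ` supp g' = supp g"
    using bij_is_surj[OF p(1)] unfolding supp_def look by (auto simp: image_iff dest: surjD)
  have "valid f' = valid f" "valid g' = valid g"
    unfolding valid_iff_proper look proper_image_vertex[OF p(1), symmetric] p(2) supp by (rule refl)+
  moreover have "supp f' = supp g'"
    using supp fg inj_image_eq_iff[OF bij_is_inj[OF p(1)]] unfolding comparable_def by metis
  moreover have "look f' ` supp f' = look f ` supp f" "look g' ` supp g' = look g ` supp g"
    unfolding look supp[symmetric] image_image by simp_all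
  ultimately show "comparable cs f' g'" using fg unfolding comparable_def by auto
  have covers: "covers f' g' c" if c: "covers f g c" for c
  proof -
    obtain T where T: "T \<in> Tri" "T \<subseteq> {v\<in>supp f. look f v = c \<or> look g v = c}"
      using c unfolding covers_def by blast
    then obtain T' where T': "T' \<in> Tri" "T = p ` T'" using p(2) by blast
    then have "T' \<subseteq> {v\<in>supp f'. look f' v = c \<or> look g' v = c}"
      using T(2) unfolding look supp_def by auto
    then show ?thesis using T'(1) unfolding covers_def by blast
  qed
  have card: "card (supp f') = card (supp f)"
    unfolding supp[symmetric] using bij_is_inj[OF p(1)] by (simp add: card_image inj_on_subset)
  have reach: "reach Tri (supp f') (set cs) n (look f') (look g') =
      reach Tri (supp f) (set cs) n (look f) (look g)" for n
    unfolding look reach_image_vertex[OF p(1), symmetric] p(2) supp by (rule refl)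
  show "short_path cs f g" if "short_path cs f' g'"
    using that covers unfolding short_path_def card reach by blast
qed

lemma swap_simps: "swap x y (swap x y z) = z" "x \<noteq> Blank \<Longrightarrow> y \<noteq> Blank \<Longrightarrow> swap x y Blank = Blank"
  by (auto simp: swap_def)

lemma color_symmetry:
  assumes xy: "x \<in> set cs" "y \<in> set cs" "Blank \<notin> set cs"
    and fg: "comparable cs f g"
  shows "comparable cs (recolor (swap x y) f) (recolor (swap x y) g)"
    "short_path cs (recolor (swap x y) f) (recolor (swap x y) g) \<Longrightarrow> short_path cs f g"
proof -
  let ?f = "recolor (swap x y) f" and ?g = "recolor (swap x y) g"
  let ?s = "swap x y"
  have ne: "x \<noteq> Blank" "y \<noteq> Blank" using xy by auto
  have inj: "?s a = ?s b \<longleftrightarrow> a = b" for a b by (metis swap_simps(1))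
  have blank: "?s a = Blank \<longleftrightarrow> a = Blank" for a using swap_simps(2)[OF ne] inj by metis
  have S: "?s ` set cs = set cs"
  proof -
    have "?s ` set cs \<subseteq> set cs" using xy by (auto simp: swap_def)
    moreover have "set cs \<subseteq> ?s ` ?s ` set cs" by (simp add: image_image swap_simps(1))
    ultimately show ?thesis by (metis image_mono subset_antisym subset_trans)
  qed
  have supp: "supp (recolor ?s h) = supp h" for h by (simp add: supp_def look_recolor blank)
  have valid: "valid (recolor ?s h) = valid h" for h
    unfolding valid_iff look_recolor comp_def inj blank by (rule refl)
  have look: "look (recolor ?s h) ` supp h \<subseteq> set cs" if "look h ` supp h \<subseteq> set cs" for h
    unfolding look_recolor image_comp[symmetric] using image_mono[OF that, of ?s] S by simp
  show fg': "comparable cs ?f ?g"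
    using fg look unfolding comparable_def supp valid by blast
  have covers: "covers ?f ?g c" if "c \<in> set cs" "\<forall>c\<in>set cs. covers f g c" for c
  proof -
    have "?s c \<in> set cs" using S that(1) by blast
    then have "covers f g (?s c)" using that(2) by blast
    moreover have "?s (look h v) = c \<longleftrightarrow> look h v = ?s c" for h v by (metis swap_simps(1))
    ultimately show ?thesis unfolding covers_def supp look_recolor comp_def by simp
  qed
  have reach: "reach Tri (supp f) (set cs) n (look f) (look g)"
    if r: "reach Tri (supp f) (set cs) n (look ?f) (look ?g)" for n
  proof -
    have "reach Tri (supp f) (?s ` set cs) n (?s \<circ> look ?f) (?s \<circ> look ?g)"
      by (rule reach_image_color[OF r])
        (use fg' inj in \<open>auto simp: comparable_def supp inj_on_def\<close>)
    moreover have "?s \<circ> look (recolor ?s h) = look h" for h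
      by (simp add: look_recolor fun_eq_iff swap_simps(1))
    ultimately show ?thesis by (simp add: S)
  qed
  show "short_path cs f g" if "short_path cs ?f ?g"
    using that covers reach unfolding short_path_def supp by blast
qed

lemma symmetry_sound:
  assumes "symmetry cs t" "Blank \<notin> set cs" "comparable cs f g"
  shows "comparable cs (t f) (t g) \<and> (short_path cs (t f) (t g) \<longrightarrow> short_path cs f g)"
  using assms(1)
proof induction
  case identity
  then show ?case using assms(3) by blast
next
  case (recolor t x y)
  then show ?case using color_symmetry[OF recolor.hyps(2,3) assms(2)] by blast
next
  case (rotate t)
  then show ?case using vertex_symmetry[OF symmetry_next look_rotate look_rotate] by blast
next
  case (double t)
  then show ?case using vertex_symmetry[OF symmetry_double look_double look_double] by blast
qed

primrec rank :: "col \<Rightarrow> nat" where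
  "rank Blank = 0" | "rank A = 1" | "rank B = 2" | "rank C = 3" | "rank D = 4"

primrec weight :: "cfg \<Rightarrow> vx list \<Rightarrow> nat" where
  "weight f [] = 0"
| "weight f (v # ws) = rank (look f v) * 5 ^ length ws + weight f ws"

lemma rank_le: "rank c \<le> 4"
  by (cases c) simp_all

lemma lt_iff: "lt a b \<longleftrightarrow> rank a < rank b"
  by (cases a; cases b) simp_all

lemma weight_less: "weight f ws < 5 ^ length ws"
proof (induction ws)
  case (Cons v ws)
  have "rank (look f v) * 5 ^ length ws \<le> 4 * 5 ^ length ws"
    using rank_le by (rule mult_le_mono1)
  then have "weight f (v # ws) < 4 * 5 ^ length ws + 5 ^ length ws"
    unfolding weight.simps using Cons by (rule add_le_less_mono)
  then show ?case by simp
qed simp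

lemma smaller_weight: "smaller f g ws \<Longrightarrow> weight f ws < weight g ws"
proof (induction ws)
  case (Cons v ws)
  show ?case
  proof (cases "look f v = look g v")
    case False
    then have "Suc (rank (look f v)) \<le> rank (look g v)"
      using Cons.prems by (simp add: Let_def lt_iff)
    then have "Suc (rank (look f v)) * 5 ^ length ws \<le> rank (look g v) * 5 ^ length ws"
      by (rule mult_le_mono1)
    then show ?thesis using weight_less[of f ws] by simp
  qed (use Cons in \<open>simp add: Let_def\<close>)
qed simp

definition canonical :: "col list \<Rightarrow> cfg \<Rightarrow> bool" where
  "canonical cs f \<longleftrightarrow> (\<forall>t. symmetry cs t \<longrightarrow> \<not> smaller (t f) f vxs)"

lemma canonical_induct:
  assumes "\<And>f g. comparable cs f g \<Longrightarrow> canonical cs f \<Longrightarrow> short_path cs f g"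
    and "Blank \<notin> set cs" "comparable cs f g"
  shows "short_path cs f g"
  using assms(3)
proof (induction "weight f vxs" arbitrary: f g rule: less_induct)
  case less
  show ?case
  proof (cases "canonical cs f")
    case True
    then show ?thesis using assms(1) less.prems by blast
  next
    case False
    then obtain t where t: "symmetry cs t" "smaller (t f) f vxs" unfolding canonical_def by blast
    then show ?thesis
      using less.hyps[OF smaller_weight[OF t(2)]] symmetry_sound[OF t(1) assms(2) less.prems] by blast
  qed
qed

lemma symmetry_comp:
  assumes "symmetry cs t" "symmetry cs s"
  shows "symmetry cs (\<lambda>f. t (s f))"
  using assms by (induction) (auto intro: symmetry.intros)

lemma normalize_symmetry:
  assumes "set ms \<subseteq> set cs" "Blank \<notin> set cs" "look f ` supp f \<subseteq> set cs"
  shows "\<exists>t. symmetry cs t \<and> normalize ws ms f = t f"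
  using assms(1,3)
proof (induction ws ms f rule: normalize.induct)
  case (1 v ws m ms f)
  let ?c = "look f v"
  show ?case
  proof (cases "lt ?c m")
    case True
    then show ?thesis using 1 by (simp add: Let_def)
  next
    case False
    have m: "m \<in> set cs" "m \<noteq> Blank" using "1.prems"(1) assms(2) by auto
    show ?thesis
    proof (cases "?c = m")
      case True
      then show ?thesis using 1(2)[OF refl False] "1.prems" False by (simp add: Let_def)
    next
      case c: False
      have "?c \<noteq> Blank" using False m(2) by (cases m) (auto simp: lt_iff)
      then have cs: "?c \<in> set cs" using "1.prems"(2) unfolding supp_def by auto
      let ?u = "recolor (swap ?c m) f"
      have "look ?u ` supp ?u \<subseteq> set cs"
      proof
        fix d assume "d \<in> look ?u ` supp ?u"
        then obtain w where w: "d = swap ?c m (look f w)" "d \<noteq> Blank"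
          unfolding supp_def by (auto simp: look_recolor)
        show "d \<in> set cs"
        proof (cases "look f w = Blank")
          case True
          then show ?thesis using w cs m(1) unfolding swap_def by (auto split: if_splits)
        next
          case False
          then have "look f w \<in> set cs" using "1.prems"(2) unfolding supp_def by auto
          then show ?thesis using w cs m(1) unfolding swap_def by auto
        qed
      qed
      then obtain t where t: "symmetry cs t" "normalize ws ms ?u = t ?u"
        using 1(2)[OF refl False] "1.prems"(1) c by auto
      have "symmetry cs (\<lambda>f. t (recolor (swap ?c m) f))"
        using symmetry_comp[OF t(1) recolor[OF identity cs m(1)]] .
      then show ?thesis using t(2) False c by (auto simp: Let_def)
    qed
  qed
qed (auto intro: identity)

lemma symmetry_rotations: "symmetry cs (rotate_cfg ^^ n)"
  by (induction n) (auto intro: symmetry.intros simp: id_def comp_def)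

lemma card_vx: "card (UNIV :: vx set) = 7"
  using distinct_card[OF distinct_vxs] by (simp add: vxs_def[THEN arg_cong, of length])

lemma look_rotations: "look ((rotate_cfg ^^ n) f) = look f \<circ> (next_vx ^^ n)"
proof (induction n)
  case (Suc n)
  have "look ((rotate_cfg ^^ Suc n) f) = look f \<circ> ((next_vx ^^ n) \<circ> next_vx)"
    using Suc by (simp add: look_rotate fun_eq_iff)
  then show ?case by (simp only: funpow_Suc_right)
qed simp

lemma next_vx_orbit: "\<exists>n. (next_vx ^^ n) V0 = v"
proof (cases v)
  case V0 then show ?thesis by (intro exI[of _ 0]) simp
next
  case V1 then show ?thesis by (intro exI[of _ 1]) simp
next
  case V2 then show ?thesis by (intro exI[of _ 2]) (simp add: numeral_eq_Suc)
next
  case V3 then show ?thesis by (intro exI[of _ 3]) (simp add: numeral_eq_Suc)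
next
  case V4 then show ?thesis by (intro exI[of _ 4]) (simp add: numeral_eq_Suc)
next
  case V5 then show ?thesis by (intro exI[of _ 5]) (simp add: numeral_eq_Suc)
next
  case V6 then show ?thesis by (intro exI[of _ 6]) (simp add: numeral_eq_Suc)
qed

lemma canonical_blank:
  assumes "canonical cs f" "look f v = Blank"
  shows "look f V0 = Blank"
proof (rule ccontr)
  assume "look f V0 \<noteq> Blank"
  moreover obtain n where "(next_vx ^^ n) V0 = v" using next_vx_orbit by blast
  then have "look ((rotate_cfg ^^ n) f) V0 = Blank" using assms(2) by (simp add: look_rotations)
  ultimately have "smaller ((rotate_cfg ^^ n) f) f vxs" by (simp add: vxs_def Let_def lt_iff)
     (cases "look f V0"; simp)
  then show False using assms(1) symmetry_rotations unfolding canonical_def by blast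
qed

lemma canonical_first:
  assumes "canonical cs f" "A \<in> set cs" "Blank \<notin> set cs" "look f ` supp f \<subseteq> set cs"
  shows "look f V0 \<in> {Blank, A}" "look f V0 = Blank \<Longrightarrow> look f V1 \<in> {Blank, A}"
proof -
  have min: "\<not> smaller (recolor (swap (look f v) A) f) f vxs" if "look f v \<noteq> Blank" for v
  proof -
    have "look f v \<in> set cs" using that assms(4) unfolding supp_def by auto
    from recolor[OF identity this assms(2)] show ?thesis
      using assms(1) unfolding canonical_def by blast
  qed
  have A: "lt A c" if "c \<noteq> Blank" "c \<noteq> A" for c using that by (cases c) simp_all
  show "look f V0 \<in> {Blank, A}"
    using min[of V0] A[of "look f V0"]
    by (cases "look f V0 = Blank"; cases "look f V0 = A")
      (simp_all add: vxs_def Let_def look_recolor swap_def)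
  show "look f V1 \<in> {Blank, A}" if "look f V0 = Blank"
    using that min[of V1] A[of "look f V1"]
    by (cases "look f V1 = Blank"; cases "look f V1 = A")
      (simp_all add: vxs_def Let_def look_recolor swap_def)
qed

lemma canonical_not_reducible:
  assumes "canonical cs f" "Blank \<notin> set cs" "comparable cs f f"
  shows "\<not> reducible cs f"
proof
  have min: "\<not> rotation_smaller cs n (t f) f" if "symmetry cs t" for n t
    using that
  proof (induction n arbitrary: t)
    case (Suc n)
    have "comparable cs (t f) (t f)" using symmetry_sound[OF Suc.prems assms(2,3)] by blast
    then obtain t' where "symmetry cs t'" "normalize vxs cs (t f) = t' (t f)"
      using normalize_symmetry[OF subset_refl assms(2), of "t f" vxs] unfolding comparable_def by blast
    then have "\<not> smaller (normalize vxs cs (t f)) f vxs"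
      using symmetry_comp[OF _ Suc.prems] assms(1) unfolding canonical_def by fastforce
    then show ?case using Suc.IH[OF rotate[OF Suc.prems]] by simp
  qed simp
  assume "reducible cs f"
  then show False
    using min[OF identity] min[OF double[OF identity]] min[OF double[OF double[OF identity]]]
    unfolding reducible_def Let_def by (auto split: if_splits)
qed

lemma extends_fill:
  assumes "extends p g" "comparable cs f g"
  shows "look g v \<in> set (fill cs f p v)"
proof -
  have "look g v \<in> set cs" if "look f v \<noteq> Blank"
    using that assms(2) unfolding comparable_def supp_def by blast
  moreover have "look g v = Blank" if "look f v = Blank"
    using that assms(2) unfolding comparable_def supp_def by blast
  ultimately show ?thesis using assms(1) unfolding extends_def fill_def by auto
qed

lemma short_path3:
  assumes "comparable [A, B, C] f g"
  shows "short_path [A, B, C] f g"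
  using _ _ assms
proof (rule canonical_induct)
  fix f g assume fg: "comparable [A, B, C] f g" and f: "canonical [A, B, C] f"
  then have ff: "comparable [A, B, C] f f" unfolding comparable_def by blast
  have cols: "look f v \<in> {Blank, A, B, C}" for v
    using fg unfolding comparable_def supp_def by auto
  have "check3 f"
    by (rule extensions_sound[OF all_check3 _ extends_blank])
      (use fg f cols canonical_first(1)[OF f] in \<open>auto simp: comparable_def first_choice_def\<close>)
  then have "extensions (fill [A, B, C] f) (solve [A, B, C] f) vxs blank"
    using canonical_not_reducible[OF f _ ff] unfolding check3_def by simp
  then have "solve [A, B, C] f g"
    by (rule extensions_sound[OF _ _ extends_blank])
      (use fg extends_fill[OF _ fg] in \<open>auto simp: comparable_def\<close>)
  then show "short_path [A, B, C] f g"
    using solve_sound[of "[A, B, C]" f g] fg unfolding comparable_def short_path_def by simp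
qed simp

lemma differences_le: "supp f = supp g \<Longrightarrow> differences f g ws \<le> differences f blank ws"
proof (induction ws)
  case (Cons v ws)
  have "look blank v = Blank" by (cases v) (simp_all add: blank_def)
  moreover have "look f v \<noteq> look g v \<Longrightarrow> look f v \<noteq> Blank"
    using Cons.prems unfolding supp_def by fastforce
  ultimately show ?case using Cons by auto
qed simp

lemma short_path4:
  assumes "comparable [A, B, C, D] f g"
  shows "short_path [A, B, C, D] f g"
  using _ _ assms
proof (rule canonical_induct)
  let ?cs = "[A, B, C, D]"
  fix f g assume fg: "comparable ?cs f g" and f: "canonical ?cs f"
  then have ff: "comparable ?cs f f" unfolding comparable_def by blast
  have supp: "supp f = supp g" using fg by (simp add: comparable_def)
  show "short_path ?cs f g"
    unfolding short_path_def
  proof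
    assume "length ?cs = 4 \<longrightarrow> 6 \<le> card (supp f) \<and> (\<forall>c\<in>set ?cs. covers f g c)"
    then have card: "6 \<le> card (supp f)" and covers: "\<And>c. c \<in> set ?cs \<Longrightarrow> covers f g c" by auto
    have cols: "look f v \<in> {A, B, C, D}" if "look f v \<noteq> Blank" for v
      using that by (cases "look f v") auto
    have "check4 f"
    proof (cases "look f V0 = Blank")
      case True
      have "look f v \<noteq> Blank" if "v \<noteq> V0" for v
      proof
        assume "look f v = Blank"
        then have "supp f \<subseteq> UNIV - {V0, v}" using True unfolding supp_def by auto
        then have "card (supp f) \<le> card (UNIV - {V0, v})" by (intro card_mono) auto
        also have "\<dots> = card (UNIV :: vx set) - 2" using that by (simp add: card_Diff_subset)
        finally show False using card card_vx by linarith
      qed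
      then show ?thesis
        by (intro extensions_sound[OF all_check4_blank _ extends_blank])
          (use fg True cols canonical_first(2)[OF f] in \<open>auto simp: comparable_def blank_choice_def\<close>)
    next
      case False
      then have "look f v \<noteq> Blank" for v using canonical_blank[OF f] by blast
      then show ?thesis
        by (intro extensions_sound[OF all_check4 _ extends_blank])
          (use fg False cols canonical_first(1)[OF f] in \<open>auto simp: comparable_def full_choice_def\<close>)
    qed
    moreover have "\<exists>v. look f v = c" if c: "c \<in> set ?cs" for c
    proof (rule ccontr)
      assume *: "\<not> (\<exists>v. look f v = c)"
      obtain T where T: "T \<in> Tri" "T \<subseteq> {v\<in>supp f. look f v = c \<or> look g v = c}"
        using covers[OF c] unfolding covers_def by blast
      then have "T \<subseteq> supp g" "\<forall>v\<in>T. look g v = c" using * supp by auto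
      then show False using T(1) fg unfolding comparable_def valid_iff_proper proper_def by blast
    qed
    ultimately have "cover f (extensions (fill ?cs f) (direct_if_valid f) vxs) ?cs blank"
      using canonical_not_reducible[OF f _ ff] unfolding check4_def by (simp split: if_splits) metis
    from cover_sound[OF this extends_blank covers]
    obtain p where p: "extends p g" "extensions (fill ?cs f) (direct_if_valid f) vxs p" by auto
    have "direct_if_valid f g"
      by (rule extensions_sound[OF p(2) _ p(1)])
        (use fg extends_fill[OF _ fg] in \<open>auto simp: comparable_def\<close>)
    then have "direct (differences f g vxs) f g"
      using fg by (simp add: direct_if_valid_def comparable_def)
    then have "reach Tri (supp f) (set ?cs) (differences f g vxs) (look f) (look g)"
      using direct_sound[of _ f g "set ?cs"] fg unfolding comparable_def by simp
    moreover have "differences f g vxs \<le> card (supp f) + 1"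
      using differences_le[OF supp, of vxs] differences_blank[OF distinct_vxs, of f] by simp
    ultimately show "reach Tri (supp f) (set ?cs) (card (supp f) + 1) (look f) (look g)"
      by (rule reach_mono)
  qed
qed simp

definition cfg_of :: "(vx \<Rightarrow> col) \<Rightarrow> cfg" where
  "cfg_of h = Cfg (h V0) (h V1) (h V2) (h V3) (h V4) (h V5) (h V6)"

lemma look_cfg_of: "look (cfg_of h) = h"
proof
  show "look (cfg_of h) v = h v" for v by (cases v) (simp_all add: cfg_of_def)
qed

lemma reach_of_short_path:
  assumes short: "\<And>F G. comparable cs F G \<Longrightarrow> short_path cs F G"
    and cs: "Blank \<notin> set cs" and s: "bij_betw s K (set cs)"
    and f: "f ` S \<subseteq> K" "proper Tri S f" and g: "g ` S \<subseteq> K" "proper Tri S g"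
    and four: "length cs = 4 \<Longrightarrow>
      6 \<le> card S \<and> (\<forall>c\<in>K. \<exists>T\<in>Tri. T \<subseteq> {x\<in>S. f x = c \<or> g x = c})"
  shows "reach Tri S K (card S + 1) f g"
proof -
  have inj: "inj_on s K" and im: "s ` K = set cs" using s by (auto simp: bij_betw_def)
  define F where "F h = cfg_of (\<lambda>v. if v \<in> S then s (h v) else Blank)" for h
  have look: "look (F h) = (\<lambda>v. if v \<in> S then s (h v) else Blank)" for h
    by (simp add: F_def look_cfg_of)
  have *: "supp (F h) = S \<and> valid (F h) \<and> look (F h) ` supp (F h) \<subseteq> set cs"
    if h: "h ` S \<subseteq> K" "proper Tri S h" for h
  proof -
    have sK: "s (h v) \<in> set cs" if "v \<in> S" for v using that h(1) im by blast
    have supp: "supp (F h) = S" using sK cs unfolding supp_def look by force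
    have "proper Tri S (look (F h))"
      unfolding proper_def
    proof (intro ballI impI notI, elim exE)
      fix T c assume T: "T \<in> Tri" "T \<subseteq> S" "\<forall>x\<in>T. look (F h) x = c"
      then have "\<forall>x\<in>T. h x = inv_into K s c"
        using h(1) inj unfolding look by (auto simp: inv_into_f_f subset_iff image_subset_iff)
      then show False using T(1,2) h(2) unfolding proper_def by blast
    qed
    then show ?thesis using sK by (auto simp: valid_iff_proper supp look)
  qed
  have cov: "covers (F f) (F g) c" if c: "c \<in> set cs" "length cs = 4" for c
  proof -
    obtain d where d: "d \<in> K" "c = s d" using c(1) im by blast
    then obtain T where T: "T \<in> Tri" "T \<subseteq> {x\<in>S. f x = d \<or> g x = d}" using four[OF c(2)] by blast
    then have "T \<subseteq> {v\<in>supp (F f). look (F f) v = c \<or> look (F g) v = c}"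
      using *[OF f] d(2) unfolding look by auto
    then show ?thesis using T(1) unfolding covers_def by blast
  qed
  have "comparable cs (F f) (F g)" using *[OF f] *[OF g] unfolding comparable_def by metis
  then have "short_path cs (F f) (F g)" by (rule short)
  then have r: "reach Tri S (set cs) (card S + 1) (look (F f)) (look (F g))"
    using *[OF f] four cov unfolding short_path_def by auto
  let ?r = "inv_into K s"
  have "reach Tri S (?r ` set cs) (card S + 1) (?r \<circ> look (F f)) (?r \<circ> look (F g))"
    by (rule reach_image_color[OF r])
      (use *[OF f] *[OF g] im in \<open>auto simp: inj_on_inv_into\<close>)
  moreover have "?r ` set cs = K" using s by (metis bij_betw_def bij_betw_inv_into)
  moreover have inverse: "(?r \<circ> look (F h)) v = h v" if "h ` S \<subseteq> K" "v \<in> S" for h v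
    using that inj by (auto simp: look inv_into_f_f)
  ultimately show ?thesis
    using reach_cong[OF inverse[OF f(1)] inverse[OF g(1)], where H = Tri and K = K and n = "card S + 1"]
    by (simp only:)
qed

lemma reach_Tri:
  assumes "card K \<ge> 3" "f ` S \<subseteq> K" "g ` S \<subseteq> K" "proper Tri S f" "proper Tri S g"
  shows "reach Tri S K (card S + 1) f g"
proof (rule reach_of_small_color_sets[where V = "UNIV :: vx set"])
  show "card T = 3" if T: "T \<in> Tri" for T
  proof -
    obtain x y z where "(x, y, z) \<in> set triangles" "T = {x, y, z}" using T unfolding Tri_eq by auto
    then show ?thesis by (auto simp: triangles_def)
  qed
  show "card (UNIV :: vx set) \<le> 7" using card_vx by simp
next
  fix S :: "vx set" and K :: "'a set" and f g
  assume *: "card K = 3" "f ` S \<subseteq> K" "g ` S \<subseteq> K" "proper Tri S f" "proper Tri S g"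
  then obtain s where "bij_betw s K (set [A, B, C])"
    using finite_same_card_bij[of K "set [A, B, C]"] by (auto simp: card_ge_0_finite)
  from reach_of_short_path[OF short_path3 _ this *(2,4,3,5)]
  show "reach Tri S K (card S + 1) f g" by simp
next
  fix S :: "vx set" and K :: "'a set" and f g
  assume *: "6 \<le> card S" "card K = 4" "f ` S \<subseteq> K" "g ` S \<subseteq> K" "proper Tri S f" "proper Tri S g"
    and cov: "\<And>c. c \<in> K \<Longrightarrow> \<exists>T\<in>Tri. T \<subseteq> {x\<in>S. f x = c \<or> g x = c}"
  then obtain s where "bij_betw s K (set [A, B, C, D])"
    using finite_same_card_bij[of K "set [A, B, C, D]"] by (auto simp: card_ge_0_finite)
  from reach_of_short_path[OF short_path4 _ this *(3,5,4,6)]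
  show "reach Tri S K (card S + 1) f g" using *(1) cov by simp
qed (use assms in auto)

section \<open>The tournament and its dicoloring graph\<close>

definition arc7 :: "7 \<Rightarrow> 7 \<Rightarrow> bool" where
  "arc7 x y \<longleftrightarrow> y = x + 1 \<or> y = x + 2 \<or> y = x - 3"

fun vertex :: "vx \<Rightarrow> 7" where
  "vertex V0 = 0" | "vertex V1 = 1" | "vertex V2 = 2" | "vertex V3 = 3"
| "vertex V4 = 4" | "vertex V5 = 5" | "vertex V6 = 6"

fun successors :: "vx \<Rightarrow> vx list" where
  "successors V0 = [V1, V2, V4]" | "successors V1 = [V2, V3, V5]"
| "successors V2 = [V3, V4, V6]" | "successors V3 = [V4, V5, V0]"
| "successors V4 = [V5, V6, V1]" | "successors V5 = [V6, V0, V2]"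
| "successors V6 = [V0, V1, V3]"

definition triangles7 :: "7 set set" where
  "triangles7 = (`) vertex ` Tri"

lemma bij_vertex: "bij vertex"
proof -
  have inj: "inj vertex"
  proof (rule injI)
    show "u = v" if "vertex u = vertex v" for u v
      using that by (cases u; cases v) simp_all
  qed
  have "card (range vertex) = card (UNIV :: 7 set)"
    using inj by (simp add: card_image card_vx)
  then have "range vertex = UNIV" by (intro card_subset_eq) simp_all
  then show ?thesis using inj by (simp add: bij_def)
qed

lemma arc7_vertex: "arc7 (vertex u) (vertex v) \<longleftrightarrow> v \<in> set (successors u)"
  by (cases u; cases v) (simp_all add: arc7_def)

lemma successors_tournament:
  "u \<notin> set (successors u)" "v \<in> set (successors u) \<Longrightarrow> u \<notin> set (successors v)"
  "u \<noteq> v \<Longrightarrow> v \<in> set (successors u) \<or> u \<in> set (successors v)"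
  by (cases u; cases v; simp)+

lemma successors_cyclic:
  assumes "v \<in> set (successors u)" "w \<in> set (successors v)" "u \<in> set (successors w)"
  shows "{u, v, w} \<in> Tri"
proof -
  have "\<forall>u\<in>set vxs. \<forall>v\<in>set (successors u). \<forall>w\<in>set (successors v).
      u \<in> set (successors w) \<longrightarrow> (v, w) \<in> set (links u) \<or> (w, v) \<in> set (links u)"
    by code_simp
  then have "(v, w) \<in> set (links u) \<or> (w, v) \<in> set (links u)" using assms by simp
  moreover have "{u, v, w} = {u, w, v}" by blast
  ultimately show ?thesis unfolding Tri_def by blast
qed

lemma links_cyclic:
  assumes "(a, b) \<in> set (links v)"
  shows "a \<in> set (successors v) \<and> b \<in> set (successors a) \<and> v \<in> set (successors b) \<or>
    b \<in> set (successors v) \<and> a \<in> set (successors b) \<and> v \<in> set (successors a)"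
  using assms by (cases v; simp; elim disjE conjE; simp)

lemma vertex_cases:
  obtains v where "x = vertex v"
  using bij_is_surj[OF bij_vertex] by (metis surjD)

lemma arc7_tournament:
  "\<not> arc7 x x" "arc7 x y \<Longrightarrow> \<not> arc7 y x" "x \<noteq> y \<Longrightarrow> arc7 x y \<or> arc7 y x"
proof -
  obtain u v where "x = vertex u" "y = vertex v" using vertex_cases by metis
  then show "\<not> arc7 x x" "arc7 x y \<Longrightarrow> \<not> arc7 y x" "x \<noteq> y \<Longrightarrow> arc7 x y \<or> arc7 y x"
    using successors_tournament by (simp_all add: arc7_vertex) metis+
qed

lemma triangles7_iff:
  "T \<in> triangles7 \<longleftrightarrow> (\<exists>x y z. T = {x, y, z} \<and> arc7 x y \<and> arc7 y z \<and> arc7 z x)"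
proof
  assume "T \<in> triangles7"
  then obtain v a b where T: "T = vertex ` {v, a, b}" "(a, b) \<in> set (links v)"
    unfolding triangles7_def Tri_def by blast
  have "T = {vertex v, vertex a, vertex b}" "T = {vertex v, vertex b, vertex a}"
    unfolding T(1) by auto
  then show "\<exists>x y z. T = {x, y, z} \<and> arc7 x y \<and> arc7 y z \<and> arc7 z x"
    using links_cyclic[OF T(2)] unfolding arc7_vertex[symmetric] by metis
next
  assume "\<exists>x y z. T = {x, y, z} \<and> arc7 x y \<and> arc7 y z \<and> arc7 z x"
  then obtain x y z where T: "T = {x, y, z}" "arc7 x y" "arc7 y z" "arc7 z x" by blast
  obtain u v w where *: "x = vertex u" "y = vertex v" "z = vertex w" using vertex_cases by metis
  have "{u, v, w} \<in> Tri"
    by (rule successors_cyclic) (use T * in \<open>simp_all add: arc7_vertex\<close>)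
  then show "T \<in> triangles7" unfolding triangles7_def T * by (intro image_eqI) auto
qed

lemma C7_3_simps [simp]:
  "verts C7_3 = UNIV" "(x, y) \<in> arcs C7_3 \<longleftrightarrow> arc7 x y" "tail C7_3 = fst" "head C7_3 = snd"
  by (auto simp: C7_3_def arc7_def)

lemma acyclic_iff: "acyclic_digraph (C7_3 \<restriction> X) \<longleftrightarrow> \<not> (\<exists>T\<in>triangles7. T \<subseteq> X)"
proof
  assume ac: "acyclic_digraph (C7_3 \<restriction> X)"
  show "\<not> (\<exists>T\<in>triangles7. T \<subseteq> X)"
  proof
    assume "\<exists>T\<in>triangles7. T \<subseteq> X"
    then obtain T where T: "T \<in> triangles7" "T \<subseteq> X" by blast
    then obtain x y z where *: "{x, y, z} \<subseteq> X" "arc7 x y" "arc7 y z" "arc7 z x"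
      using triangles7_iff[of T] by blast
    then have "x \<noteq> y" "y \<noteq> z" "z \<noteq> x" using arc7_tournament(1) by metis+
    then have "pre_digraph.cycle (C7_3 \<restriction> X) [(x, y), (y, z), (z, x)]"
      unfolding pre_digraph.cycle_def
      using * by (intro exI[of _ x]) (auto simp: pre_digraph.awalk_def pre_digraph.cas.simps
        pre_digraph.awalk_verts.simps)
    then show False using ac unfolding acyclic_digraph_def by blast
  qed
next
  assume no: "\<not> (\<exists>T\<in>triangles7. T \<subseteq> X)"
  let ?r = "{(x, y). x \<in> X \<and> y \<in> X \<and> arc7 x y}"
  have "wf_digraph C7_3" by unfold_locales simp_all
  then interpret wf_digraph "C7_3 \<restriction> X" by (rule wf_digraph.wellformed_induce_subgraph)
  have ends: "arcs_ends (C7_3 \<restriction> X) = ?r"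
    unfolding arcs_ends_def arc_to_ends_def by force
  have "trans ?r"
  proof (rule transI)
    fix x y z assume "(x, y) \<in> ?r" "(y, z) \<in> ?r"
    then have *: "x \<in> X" "y \<in> X" "z \<in> X" "arc7 x y" "arc7 y z" by auto
    have "\<not> arc7 z x"
    proof
      assume "arc7 z x"
      then have "{x, y, z} \<in> triangles7" using *(4,5) unfolding triangles7_iff by blast
      moreover have "{x, y, z} \<subseteq> X" using *(1-3) by simp
      ultimately show False using no by blast
    qed
    moreover have "x \<noteq> z" using * arc7_tournament(2) by blast
    ultimately show "(x, z) \<in> ?r" using * arc7_tournament(3) by blast
  qed
  show "acyclic_digraph (C7_3 \<restriction> X)"
    unfolding acyclic_digraph_def
  proof
    assume "\<exists>p. cycle p"
    then obtain u p where "awalk u p u" "p \<noteq> []" unfolding cycle_def by blast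
    then have "(u, u) \<in> ?r\<^sup>+" using reachable1_awalkI unfolding ends by blast
    then show False using trancl_id[OF \<open>trans ?r\<close>] arc7_tournament(1) by auto
  qed
qed

lemma dicolorings_iff:
  "\<alpha> \<in> dicolorings k C7_3 \<longleftrightarrow> range \<alpha> \<subseteq> {1..k} \<and> proper triangles7 UNIV \<alpha>"
proof -
  have "(\<forall>i\<in>{1..k}. \<not> (\<exists>T\<in>triangles7. T \<subseteq> {x. \<alpha> x = i})) \<longleftrightarrow> proper triangles7 UNIV \<alpha>"
    if r: "range \<alpha> \<subseteq> {1..k}"
  proof
    assume *: "\<forall>i\<in>{1..k}. \<not> (\<exists>T\<in>triangles7. T \<subseteq> {x. \<alpha> x = i})"
    show "proper triangles7 UNIV \<alpha>"
      unfolding proper_def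
    proof (intro ballI impI notI, elim exE)
      fix T c assume T: "T \<in> triangles7" "\<forall>x\<in>T. \<alpha> x = c"
      then obtain x where "x \<in> T" unfolding triangles7_iff by blast
      then have "c \<in> {1..k}" using T(2) r by (metis rangeI subsetD)
      then show False using * T by blast
    qed
  next
    assume *: "proper triangles7 UNIV \<alpha>"
    show "\<forall>i\<in>{1..k}. \<not> (\<exists>T\<in>triangles7. T \<subseteq> {x. \<alpha> x = i})"
    proof (intro ballI notI, elim bexE)
      fix i T assume T: "T \<in> triangles7" "T \<subseteq> {x. \<alpha> x = i}"
      have "\<not> (\<exists>c. \<forall>x\<in>T. \<alpha> x = c)" using * T(1) unfolding proper_def by simp
      then show False using T(2) by blast
    qed
  qed
  moreover have "\<alpha> \<in> UNIV \<rightarrow>\<^sub>E {1..k} \<longleftrightarrow> range \<alpha> \<subseteq> {1..k}"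
    unfolding PiE_UNIV_domain by (simp add: Pi_iff image_subset_iff)
  ultimately show ?thesis
    unfolding dicolorings_def by (simp add: acyclic_iff) blast
qed

lemma reach_dicolorings:
  assumes "k \<ge> 3" "\<alpha> \<in> dicolorings k C7_3" "\<beta> \<in> dicolorings k C7_3"
  shows "reach triangles7 UNIV {1..k} 8 \<alpha> \<beta>"
proof -
  have UNIV: "vertex ` UNIV = UNIV" using bij_vertex by (simp add: bij_def)
  have proper: "proper Tri UNIV (\<gamma> \<circ> vertex)" "(\<gamma> \<circ> vertex) ` UNIV \<subseteq> {1..k}"
    if "\<gamma> \<in> dicolorings k C7_3" for \<gamma>
    using that proper_image_vertex[OF bij_vertex, of Tri UNIV \<gamma>]
    unfolding dicolorings_iff triangles7_def UNIV by auto
  have "reach Tri UNIV {1..k} (card (UNIV :: vx set) + 1) (\<alpha> \<circ> vertex) (\<beta> \<circ> vertex)"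
    using assms by (intro reach_Tri proper) simp_all
  then show ?thesis
    using reach_image_vertex[OF bij_vertex, of Tri UNIV "{1..k}" 8 \<alpha> \<beta>]
    unfolding triangles7_def UNIV card_vx by simp
qed

definition disagreement :: "(7 \<Rightarrow> nat) \<Rightarrow> (7 \<Rightarrow> nat) \<Rightarrow> nat" where
  "disagreement \<alpha> \<beta> = card {x. \<alpha> x \<noteq> \<beta> x}"

lemma disagreement_upd:
  "disagreement \<alpha> \<beta> \<le> Suc (disagreement (\<alpha>(x := c)) \<beta>)"
  "c \<noteq> \<beta> x \<Longrightarrow> disagreement \<alpha> \<beta> \<le> disagreement (\<alpha>(x := c)) \<beta>"
proof -
  have "disagreement \<alpha> \<beta> \<le> card (insert x {y. (\<alpha>(x := c)) y \<noteq> \<beta> y})"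
    unfolding disagreement_def by (rule card_mono) auto
  also have "\<dots> \<le> Suc (disagreement (\<alpha>(x := c)) \<beta>)"
    unfolding disagreement_def by (subst card_insert_if) simp_all
  finally show "disagreement \<alpha> \<beta> \<le> Suc (disagreement (\<alpha>(x := c)) \<beta>)" .
  show "disagreement \<alpha> \<beta> \<le> disagreement (\<alpha>(x := c)) \<beta>" if "c \<noteq> \<beta> x"
    unfolding disagreement_def by (rule card_mono) (use that in auto)
qed

definition start :: "7 \<Rightarrow> nat" where
  "start x = (if x \<in> {0, 1, 2} then 1 else if x \<in> {3, 6} then 2 else 3)"

definition target :: "7 \<Rightarrow> nat" where
  "target x = (if x \<in> {3, 6} then 1 else if x \<in> {1, 4, 5} then 2 else 3)"

lemma start_simps:
  "start 0 = 1" "start 1 = 1" "start 2 = 1" "start 3 = 2" "start 4 = 3" "start 5 = 3" "start 6 = 2"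
  by (simp_all add: start_def)

lemma target_simps:
  "target 0 = 3" "target 1 = 2" "target 2 = 3" "target 3 = 1" "target 4 = 2" "target 5 = 2"
  "target 6 = 1"
  by (simp_all add: target_def)

lemma all7: "(\<forall>x. P x) \<longleftrightarrow> P 0 \<and> P 1 \<and> P 2 \<and> P 3 \<and> P 4 \<and> P 5 \<and> P (6 :: 7)"
proof -
  have "P (vertex v)" if "P 0 \<and> P 1 \<and> P 2 \<and> P 3 \<and> P 4 \<and> P 5 \<and> P 6" for v
    using that by (cases v) simp_all
  then show ?thesis by (metis vertex_cases)
qed

lemma proper7:
  "proper triangles7 UNIV \<alpha> \<longleftrightarrow> (\<forall>(x, y, z)\<in>set triangles.
     \<not> (\<alpha> (vertex x) = \<alpha> (vertex y) \<and> \<alpha> (vertex y) = \<alpha> (vertex z)))"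
proof -
  have "proper triangles7 UNIV \<alpha> \<longleftrightarrow> proper Tri UNIV (\<alpha> \<circ> vertex)"
    using proper_image_vertex[OF bij_vertex, of Tri UNIV \<alpha>] bij_is_surj[OF bij_vertex]
    by (simp add: triangles7_def)
  also have "\<dots> \<longleftrightarrow> (\<forall>(x, y, z)\<in>set triangles. \<not> (\<exists>c. \<forall>v\<in>{x, y, z}. \<alpha> (vertex v) = c))"
    unfolding proper_def Tri_eq by (simp add: case_prod_unfold) metis
  also have "\<dots> \<longleftrightarrow> (\<forall>(x, y, z)\<in>set triangles.
     \<not> (\<alpha> (vertex x) = \<alpha> (vertex y) \<and> \<alpha> (vertex y) = \<alpha> (vertex z)))"
    by (intro ball_cong refl) (clarsimp, metis)
  finally show ?thesis .
qed

context
  fixes k :: nat and G :: "(7 \<Rightarrow> nat, (7 \<Rightarrow> nat) \<times> (7 \<Rightarrow> nat)) pre_digraph"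
  defines "G \<equiv> dicoloring_graph k C7_3"
begin

interpretation wf_digraph G
  unfolding G_def by (rule graph_properties_dicoloring_graph)

lemma verts_G: "verts G = dicolorings k C7_3"
  by (simp add: G_def dicoloring_graph_def)

lemma arc_G:
  "(\<alpha>, \<beta>) \<in> arcs G \<longleftrightarrow> \<alpha> \<in> verts G \<and> \<beta> \<in> verts G \<and> (\<exists>x. \<alpha> x \<noteq> \<beta> x \<and> \<beta> = \<alpha>(x := \<beta> x))"
proof -
  have "(\<exists>!x. \<alpha> x \<noteq> \<beta> x) \<longleftrightarrow> (\<exists>x. \<alpha> x \<noteq> \<beta> x \<and> \<beta> = \<alpha>(x := \<beta> x))"
    unfolding fun_eq_iff by (metis fun_upd_apply)
  then show ?thesis by (simp add: verts_G) (simp add: G_def dicoloring_graph_def)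
qed

lemma ends_G: "tail G = fst" "head G = snd"
  by (simp_all add: G_def dicoloring_graph_def)

lemma reach_walk:
  assumes "reach triangles7 UNIV {1..k} n \<alpha> \<beta>" "\<alpha> \<in> verts G"
  shows "\<exists>p. awalk \<alpha> p \<beta> \<and> length p \<le> n"
  using assms
proof (induction n arbitrary: \<alpha>)
  case 0
  then have "\<alpha> = \<beta>" by auto
  then show ?case using 0 by (intro exI[of _ "[]"]) (simp add: awalk_Nil_iff)
next
  case (Suc n)
  show ?case
  proof (cases "\<alpha> = \<beta>")
    case True
    then show ?thesis using Suc.prems by (intro exI[of _ "[]"]) (simp add: awalk_Nil_iff)
  next
    case False
    then obtain x c where x: "c \<in> {1..k}" "proper triangles7 UNIV (\<alpha>(x := c))"
      "reach triangles7 UNIV {1..k} n (\<alpha>(x := c)) \<beta>"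
      using Suc.prems(1) unfolding reach.simps by blast
    have v: "\<alpha>(x := c) \<in> verts G"
      using x(1,2) Suc.prems(2) unfolding verts_G dicolorings_iff by auto
    obtain p where p: "awalk (\<alpha>(x := c)) p \<beta>" "length p \<le> n" using Suc.IH[OF x(3) v] by blast
    show ?thesis
    proof (cases "\<alpha> x = c")
      case True
      then have "\<alpha>(x := c) = \<alpha>" by auto
      then show ?thesis using p by (intro exI[of _ p]) simp
    next
      case False
      then have "(\<alpha>, \<alpha>(x := c)) \<in> arcs G" using v Suc.prems(2) unfolding arc_G by auto
      then show ?thesis
        using p by (intro exI[of _ "(\<alpha>, \<alpha>(x := c)) # p"]) (simp add: awalk_Cons_iff ends_G)
    qed
  qed
qed

lemma disagreement_le_length: "awalk \<alpha> p \<beta> \<Longrightarrow> disagreement \<alpha> \<beta> \<le> length p"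
proof (induction p arbitrary: \<alpha>)
  case Nil
  then show ?case by (simp add: awalk_Nil_iff disagreement_def)
next
  case (Cons e p)
  obtain \<gamma> where e: "e = (\<alpha>, \<gamma>)" "(\<alpha>, \<gamma>) \<in> arcs G" "awalk \<gamma> p \<beta>"
    using Cons.prems by (cases e) (auto simp: awalk_Cons_iff ends_G)
  obtain x where "\<gamma> = \<alpha>(x := \<gamma> x)" using e(2) unfolding arc_G by blast
  then have "disagreement \<alpha> \<beta> \<le> Suc (disagreement \<gamma> \<beta>)" using disagreement_upd(1) by metis
  then show ?case using Cons.IH[OF e(3)] by simp
qed

lemma tight_walk_step:
  assumes "awalk \<alpha> p \<beta>" "length p \<le> disagreement \<alpha> \<beta>" "\<alpha> \<noteq> \<beta>"
  obtains x q where "\<alpha> x \<noteq> \<beta> x" "proper triangles7 UNIV (\<alpha>(x := \<beta> x))"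
    "awalk (\<alpha>(x := \<beta> x)) q \<beta>" "length q \<le> disagreement (\<alpha>(x := \<beta> x)) \<beta>"
proof (cases p)
  case Nil
  then show ?thesis using assms by (simp add: awalk_Nil_iff)
next
  case (Cons e q)
  obtain \<gamma> where e: "e = (\<alpha>, \<gamma>)" "(\<alpha>, \<gamma>) \<in> arcs G" "awalk \<gamma> q \<beta>"
    using assms(1) unfolding Cons by (cases e) (auto simp: awalk_Cons_iff ends_G)
  obtain x where x: "\<alpha> x \<noteq> \<gamma> x" "\<gamma> = \<alpha>(x := \<gamma> x)" using e(2) unfolding arc_G by blast
  have "disagreement \<gamma> \<beta> \<le> length q" using disagreement_le_length[OF e(3)] .
  then have less: "disagreement \<gamma> \<beta> < disagreement \<alpha> \<beta>" using assms(2) Cons by simp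
  have "\<gamma> x = \<beta> x"
  proof (rule ccontr)
    assume "\<gamma> x \<noteq> \<beta> x"
    from disagreement_upd(2)[of "\<gamma> x" \<beta> x \<alpha>, OF this] show False using less x(2) by simp
  qed
  moreover have "length q \<le> disagreement \<gamma> \<beta>"
    using assms(2) Cons disagreement_upd(1)[of \<alpha> \<beta> x "\<gamma> x"] x(2) by simp
  moreover have "proper triangles7 UNIV \<gamma>" using e(2) unfolding arc_G verts_G dicolorings_iff by blast
  ultimately show ?thesis using that[of x q] x e(3) by metis
qed

text \<open>From \<open>start\<close> only vertex 1 can get its final color, and after this step no other vertex can.\<close>

lemma no_short_walk:
  assumes "awalk start p target"
  shows "8 \<le> length p"
proof (rule ccontr)
  assume "\<not> 8 \<le> length p"
  moreover have ne: "start x \<noteq> target x" for x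
    using all7[of "\<lambda>x. start x \<noteq> target x"] by (simp add: start_simps target_simps)
  then have "disagreement start target = 7" by (simp add: disagreement_def)
  ultimately have "length p \<le> disagreement start target" by simp
  then obtain x q where x: "proper triangles7 UNIV (start(x := target x))"
    "awalk (start(x := target x)) q target"
    "length q \<le> disagreement (start(x := target x)) target"
    using tight_walk_step[OF assms] ne by metis
  have "\<forall>x. proper triangles7 UNIV (start(x := target x)) \<longrightarrow> x = 1"
    unfolding all7 by (simp add: proper7 triangles_def start_simps target_simps)
  then have "x = 1" using x(1) by blast
  let ?\<gamma> = "start(1 := target 1)"
  have "?\<gamma> 0 \<noteq> target 0" using ne by simp
  then have "?\<gamma> \<noteq> target" by metis
  then obtain y where y: "?\<gamma> y \<noteq> target y" "proper triangles7 UNIV (?\<gamma>(y := target y))"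
    using tight_walk_step[OF x(2,3)[unfolded \<open>x = 1\<close>]] by metis
  have "\<forall>y. ?\<gamma> y \<noteq> target y \<longrightarrow> \<not> proper triangles7 UNIV (?\<gamma>(y := target y))"
    unfolding all7 by (simp add: proper7 triangles_def start_simps target_simps)
  then show False using y by blast
qed

lemma start_target:
  assumes "k \<ge> 3"
  shows "start \<in> verts G" "target \<in> verts G"
proof -
  have "range start \<subseteq> {1..k}" "range target \<subseteq> {1..k}"
    using assms by (auto simp: start_def target_def)
  moreover have "proper triangles7 UNIV start" "proper triangles7 UNIV target"
    by (simp_all add: proper7 triangles_def start_simps target_simps)
  ultimately show "start \<in> verts G" "target \<in> verts G"
    unfolding verts_G dicolorings_iff by blast+
qed

lemma cost_length: "awalk_cost (\<lambda>_. 1) p = length p"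
  by (induction p) simp_all

lemma dicoloring_graph_connected_diameter:
  assumes "k \<ge> 3"
  shows "Digraph_Component.connected G \<and> graph_diameter G = 8"
proof
  have walk: "\<exists>p. awalk \<alpha> p \<beta> \<and> length p \<le> 8" if "\<alpha> \<in> verts G" "\<beta> \<in> verts G" for \<alpha> \<beta>
    using that reach_walk reach_dicolorings[OF assms] unfolding verts_G by blast
  have sym: "symmetric G"
    using graph_properties_dicoloring_graph(3) unfolding G_def sym_digraph_def sym_digraph_axioms_def
    by blast
  show "Digraph_Component.connected G"
  proof (rule connectedI)
    show "verts G \<noteq> {}" using start_target[OF assms] by blast
    fix \<alpha> \<beta> assume "\<alpha> \<in> verts G" "\<beta> \<in> verts G"
    then have "\<alpha> \<rightarrow>\<^sup>*\<^bsub>G\<^esub> \<beta>" using walk reachable_awalk by blast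
    then show "\<alpha> \<rightarrow>\<^sup>*\<^bsub>mk_symmetric G\<^esub> \<beta>" using reachable_mk_symmetric_eq[OF sym] by simp
  qed
  have dist: "graph_dist G \<alpha> \<beta> = (INF p\<in>{p. awalk \<alpha> p \<beta>}. ereal (length p))" for \<alpha> \<beta>
    unfolding graph_dist_def \<mu>_def cost_length by (rule refl)
  have "graph_dist G \<alpha> \<beta> \<le> 8" if "\<alpha> \<in> verts G" "\<beta> \<in> verts G" for \<alpha> \<beta>
  proof -
    obtain p where "awalk \<alpha> p \<beta>" "length p \<le> 8" using walk[OF \<open>\<alpha> \<in> verts G\<close> \<open>\<beta> \<in> verts G\<close>] by blast
    then show ?thesis unfolding dist by (intro INF_lower2[of p]) auto
  qed
  moreover have "8 \<le> graph_dist G start target"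
    unfolding dist using no_short_walk by (intro INF_greatest) auto
  ultimately show "graph_diameter G = 8"
    unfolding graph_diameter_def using start_target[OF assms]
    by (intro antisym SUP_least) (auto intro: SUP_upper2)
qed

end

theorem theorem5:
  fixes k :: nat
  assumes "k \<ge> 3"
  shows "Digraph_Component.connected (dicoloring_graph k C7_3) \<and>
         graph_diameter (dicoloring_graph k C7_3) = 8"
  using dicoloring_graph_connected_diameter[OF assms] .

end
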